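(* Let $\alpha\ge-\frac12$, $1\le p\le q<\infty$, and let $\psi$ be a measurable function on $\mathbb{R}$ such that $$K_\psi=\int_{\mathbb{R}}\frac{|\psi(t)|}{|t|^{d_\alpha\left(1-\frac1q\right)}}\,dt<\infty .$$ Then for all $f\in L^{p,q}(\mathbb{R},d\mu_\alpha)$ $$\|\mathcal{H}_\psi^\alpha f\|_{L^{p,q}(\mathbb{R},d\mu_\alpha)}\le K_\psi\,\|f\|_{L^{p,q}(\mathbb{R},d\mu_\alpha)} .$$
   Context: Notation: $d_\alpha=2\alpha+2$; $d\mu_\alpha(x)=A_\alpha|x|^{2\alpha+1}dx$ with $A_\alpha=(2^{\alpha+1}\Gamma(\alpha+1))^{-1}$; $B(0,r)=\,]-r,r[$ for $r>0$. Dunkl translation: put $W_\alpha(x,y,z)=(1-\sigma_{x,y,z}+\sigma_{z,x,y}+\sigma_{z,y,x})\,\kappa_\alpha(|x|,|y|,|z|)$, where $\sigma_{x,y,z}=\frac{x^2+y^2-z^2}{2xy}$ if $x,y\in\mathbb{R}\setminus\{0\}$ and $0$ otherwise, and $$\kappa_\alpha(|x|,|y|,|z|)=D_\alpha\frac{\big([(|x|+|y|)^2-z^2][z^2-(|x|-|y|)^2]\big)^{\alpha-\frac12}}{|xyz|^{2\alpha}}$$ if $|z|\in[\,||x|-|y||,\,|x|+|y|\,]$ and $0$ otherwise, with $D_\alpha=\frac{(\Gamma(\alpha+1))^2}{2^{\alpha-1}\sqrt{\pi}\,\Gamma(\alpha+\frac12)}$. Let $d\nu_{x,y}(z)=W_\alpha(x,y,z)\,d\mu_\alpha(z)$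 if $x,y\ne0$, $\nu_{x,0}=\delta_x$, $\nu_{0,y}=\delta_y$. Then $\tau_x^\alpha f(y)=\int_{\mathbb{R}}f(z)\,d\nu_{x,y}(z)$ (for continuous $f$, and by the same formula for more general functions). For $\alpha=-\frac12$, $\tau_x^\alpha f(y)=f(x+y)$. Dunkl-type Morrey space: for $1\le p\le q<\infty$, $L^{p,q}(\mathbb{R},d\mu_\alpha)$ is the class of locally $p$-integrable $f$ on $\mathbb{R}$ with $$\|f\|_{L^{p,q}(\mathbb{R},d\mu_\alpha)}:=\sup_{r>0,\,x\in\mathbb{R}}r^{d_\alpha/q}\left(\frac{1}{r^{d_\alpha}}\int_{B(0,r)}\tau_x^\alpha|f|^p(y)\,d\mu_\alpha(y)\right)^{1/p}<\infty .$$ Dunkl-type Hausdorff operator: $\mathcal{H}_\psi^\alpha f(x):=\int_{\mathbb{R}}\frac{\psi(t)}{|t|^{2\alpha+2}}f\!\left(\frac{x}{t}\right)dt$. *)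

theory Defs
  imports "HOL-Analysis.Analysis"
begin

text \<open>
  Functions are Lebesgue (not only Borel) measurable and complex valued.  The weights below may
  take Isabelle's default values where a denominator or the base of a power vanishes; for fixed
  nonzero arguments of the other variables this happens on Lebesgue null sets only.
\<close>

definition dunkl_dim :: "real \<Rightarrow> real" where
  "dunkl_dim \<alpha> = 2 * \<alpha> + 2"

definition dunkl_measure :: "real \<Rightarrow> real measure" where
  "dunkl_measure \<alpha> = density lebesgue
     (\<lambda>x. ennreal (inverse (2 powr (\<alpha> + 1) * Gamma (\<alpha> + 1)) * \<bar>x\<bar> powr (2 * \<alpha> + 1)))"

definition dunkl_sigma :: "real \<Rightarrow> real \<Rightarrow> real \<Rightarrow> real" where
  "dunkl_sigma x y z = (if x \<noteq> 0 \<and> y \<noteq> 0 then (x\<^sup>2 + y\<^sup>2 - z\<^sup>2) / (2 * x * y) else 0)"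

definition dunkl_D :: "real \<Rightarrow> real" where
  "dunkl_D \<alpha> = (Gamma (\<alpha> + 1))\<^sup>2 / (2 powr (\<alpha> - 1) * sqrt pi * Gamma (\<alpha> + 1/2))"

definition dunkl_kappa :: "real \<Rightarrow> real \<Rightarrow> real \<Rightarrow> real \<Rightarrow> real" where
  "dunkl_kappa \<alpha> a b c =
     (if \<bar>a - b\<bar> \<le> c \<and> c \<le> a + b
      then dunkl_D \<alpha> * (((a + b)\<^sup>2 - c\<^sup>2) * (c\<^sup>2 - (a - b)\<^sup>2)) powr (\<alpha> - 1/2)
             / \<bar>a * b * c\<bar> powr (2 * \<alpha>)
      else 0)"

definition dunkl_W :: "real \<Rightarrow> real \<Rightarrow> real \<Rightarrow> real \<Rightarrow> real" where
  "dunkl_W \<alpha> x y z =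
     (1 - dunkl_sigma x y z + dunkl_sigma z x y + dunkl_sigma z y x)
       * dunkl_kappa \<alpha> \<bar>x\<bar> \<bar>y\<bar> \<bar>z\<bar>"

text \<open>
  The kernel \<open>dunkl_W\<close> changes sign, so the measure \<open>\<nu>\<^sub>x\<^sub>,\<^sub>y\<close> is signed.  Integration against it is
  written out, including the Dirac cases \<open>\<nu>\<^sub>x\<^sub>,\<^sub>0 = \<delta>\<^sub>x\<close> and \<open>\<nu>\<^sub>0\<^sub>,\<^sub>y = \<delta>\<^sub>y\<close>.
\<close>

definition dunkl_translation ::
    "real \<Rightarrow> real \<Rightarrow> (real \<Rightarrow> 'a::{banach, second_countable_topology}) \<Rightarrow> real \<Rightarrow> 'a" where
  "dunkl_translation \<alpha> x f y =
     (if \<alpha> = - 1/2 then f (x + y)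
      else if y = 0 then f x
      else if x = 0 then f y
      else (LINT z|dunkl_measure \<alpha>. dunkl_W \<alpha> x y z *\<^sub>R f z))"

definition locally_p_integrable :: "real \<Rightarrow> real \<Rightarrow> (real \<Rightarrow> complex) \<Rightarrow> bool" where
  "locally_p_integrable \<alpha> p f \<longleftrightarrow>
     f \<in> borel_measurable lebesgue \<and>
     (\<forall>K. compact K \<longrightarrow> set_integrable (dunkl_measure \<alpha>) K (\<lambda>x. norm (f x) powr p))"

text \<open>
  For locally \<open>p\<close>-integrable \<open>f\<close> the integral of \<open>\<tau>\<^sub>x |f|\<^sup>p\<close> over \<open>B(0, r)\<close> converges absolutely as a
  double integral, and it is nonnegative: the odd part of \<open>dunkl_W\<close> in \<open>y\<close> cancels over the
  symmetric ball, and the even part is nonnegative.  For other \<open>f\<close> the value below has no meaning,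
  and it is always used together with local \<open>p\<close>-integrability.
\<close>

definition dunkl_morrey_norm :: "real \<Rightarrow> real \<Rightarrow> real \<Rightarrow> (real \<Rightarrow> complex) \<Rightarrow> ennreal" where
  "dunkl_morrey_norm \<alpha> p q f =
     (SUP (r, x) \<in> {0<..} \<times> UNIV.
        ennreal (r powr (dunkl_dim \<alpha> / q) *
          (1 / r powr dunkl_dim \<alpha> *
             (LINT y:ball 0 r|dunkl_measure \<alpha>.
                dunkl_translation \<alpha> x (\<lambda>z. norm (f z) powr p) y)) powr (1 / p)))"

definition dunkl_morrey :: "real \<Rightarrow> real \<Rightarrow> real \<Rightarrow> (real \<Rightarrow> complex) set" where
  "dunkl_morrey \<alpha> p q =
     {f. locally_p_integrable \<alpha> p f \<and> dunkl_morrey_norm \<alpha> p q f < \<infinity>}"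

definition hausdorff_integrand ::
    "real \<Rightarrow> (real \<Rightarrow> complex) \<Rightarrow> (real \<Rightarrow> complex) \<Rightarrow> real \<Rightarrow> real \<Rightarrow> complex" where
  "hausdorff_integrand \<alpha> \<psi> f x t = \<psi> t / of_real (\<bar>t\<bar> powr (2 * \<alpha> + 2)) * f (x / t)"

definition dunkl_hausdorff ::
    "real \<Rightarrow> (real \<Rightarrow> complex) \<Rightarrow> (real \<Rightarrow> complex) \<Rightarrow> real \<Rightarrow> complex" where
  "dunkl_hausdorff \<alpha> \<psi> f x = (LINT t|lebesgue. hausdorff_integrand \<alpha> \<psi> f x t)"

definition hausdorff_const :: "real \<Rightarrow> real \<Rightarrow> (real \<Rightarrow> complex) \<Rightarrow> ennreal" where
  "hausdorff_const \<alpha> q \<psi> =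
     (\<integral>\<^sup>+ t. ennreal (norm (\<psi> t) / \<bar>t\<bar> powr (dunkl_dim \<alpha> * (1 - 1 / q))) \<partial>lebesgue)"

end

theory Submission imports Defs begin

text \<open>
  Integrating the translation over a symmetric ball kills the part of the signed kernel that is odd
  in \<open>y\<close>, so the integral of \<open>\<tau>\<^sub>x |f|\<^sup>p\<close> over \<open>B(0, r)\<close> equals \<open>\<integral> |f|\<^sup>p \<Phi>\<^sub>x\<^sub>,\<^sub>r d\<mu>\<close> with a nonnegative kernel
  satisfying \<open>\<Phi>\<^sub>x\<^sub>,\<^sub>r(t z) = \<Phi>\<^sub>x\<^sub>/\<^sub>t\<^sub>,\<^sub>r\<^sub>/\<^sub>|\<^sub>t\<^sub>|(z)\<close>.  Hence the dilate \<open>f(\<cdot>/t)\<close> has Morrey norm at most \<open>|t|\<close> to the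
  power \<open>d/q\<close> times that of \<open>f\<close>, and Minkowski's integral inequality gives the constant \<open>K\<close>.  The exchange
  of integrals needs \<open>sup\<^sub>z \<integral> |W(x, y, z)| d\<mu>(y) < \<infinity>\<close>, which is a Beta integral.
\<close>

text \<open>Two obstacles shape the proof. The data are only Lebesgue measurable, while Tonelli and
  the map (x, t) to f (x / t) call for joint Borel measurability. So f and \<psi> are replaced by
  Borel representatives, the estimates run over \<open>dunkl_lborel\<close>, and the results return
  through almost everywhere equality. The point x = 0 is dropped on the way, since x / t then stays
  at 0 and a change of f at that single point is felt for every t. Moreover Bochner integrals
  default to 0, so the real integrals in the Morrey norm are rewritten as \<open>ennreal\<close>
  integrals, with finiteness carried along. The constant comes from splitting |t|^(-d) as |t|^(-d (1
  - 1/q)) times |t|^(-d/q). The second factor makes the Morrey bounds of all dilates equal; the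
  first, times |\<psi>|, is the density of a measure of mass K. Averaging p-th powers against it
  costs K^(p-1), integrating the common bound costs another K, and the p-th root of K^p is
  K.\<close>

section \<open>The weight and the signed kernel: bounds, parity, homogeneity\<close>

definition dunkl_weight :: "real \<Rightarrow> real \<Rightarrow> real" where
  "dunkl_weight \<alpha> x = inverse (2 powr (\<alpha> + 1) * Gamma (\<alpha> + 1)) * \<bar>x\<bar> powr (2 * \<alpha> + 1)"

text \<open>The same density on Borel sets only. \<open>dunkl_measure\<close> lives on the completed
  sigma-algebra, which does not fit the product measures used below.\<close>

definition dunkl_lborel :: "real \<Rightarrow> real measure" where
  "dunkl_lborel \<alpha> = density lborel (\<lambda>x. ennreal (dunkl_weight \<alpha> x))"

lemma dunkl_measure_eq: "dunkl_measure \<alpha> = density lebesgue (\<lambda>x. ennreal (dunkl_weight \<alpha> x))"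
  by (simp add: dunkl_measure_def dunkl_weight_def)

lemma measurable_dunkl_weight [measurable]: "dunkl_weight \<alpha> \<in> borel_measurable borel"
  unfolding dunkl_weight_def by measurable

lemma dunkl_weight_nonneg: "- 1/2 \<le> \<alpha> \<Longrightarrow> 0 \<le> dunkl_weight \<alpha> x"
  by (simp add: dunkl_weight_def)

lemma dunkl_weight_mult: "dunkl_weight \<alpha> (s * x) = \<bar>s\<bar> powr (2 * \<alpha> + 1) * dunkl_weight \<alpha> x"
  by (simp add: dunkl_weight_def abs_mult powr_mult)

lemma dunkl_D_nonneg: "- 1/2 < \<alpha> \<Longrightarrow> 0 \<le> dunkl_D \<alpha>"
  unfolding dunkl_D_def by (intro divide_nonneg_nonneg mult_nonneg_nonneg) auto

lemma dunkl_kappa_nonneg: "- 1/2 < \<alpha> \<Longrightarrow> 0 \<le> dunkl_kappa \<alpha> a b c"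
  unfolding dunkl_kappa_def using dunkl_D_nonneg[of \<alpha>] by auto

lemma dunkl_kappa_nonzeroD:
  assumes "dunkl_kappa \<alpha> \<bar>x\<bar> \<bar>y\<bar> \<bar>z\<bar> \<noteq> 0"
  shows "\<bar>x\<bar> \<le> \<bar>y\<bar> + \<bar>z\<bar>" "\<bar>y\<bar> \<le> \<bar>x\<bar> + \<bar>z\<bar>" "\<bar>z\<bar> \<le> \<bar>x\<bar> + \<bar>y\<bar>"
proof -
  have "\<bar>\<bar>x\<bar> - \<bar>y\<bar>\<bar> \<le> \<bar>z\<bar>" "\<bar>z\<bar> \<le> \<bar>x\<bar> + \<bar>y\<bar>"
    using assms by (auto simp: dunkl_kappa_def split: if_splits)
  then show "\<bar>x\<bar> \<le> \<bar>y\<bar> + \<bar>z\<bar>" "\<bar>y\<bar> \<le> \<bar>x\<bar> + \<bar>z\<bar>" "\<bar>z\<bar> \<le> \<bar>x\<bar> + \<bar>y\<bar>"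
    by linarith+
qed

text \<open>Law of cosines: in a triangle with sides |x|, |y|, |z| the value is, up to sign, the
  cosine of the angle between the first two.\<close>

lemma dunkl_sigma_le_1:
  assumes "\<bar>x\<bar> \<le> \<bar>y\<bar> + \<bar>z\<bar>" "\<bar>y\<bar> \<le> \<bar>x\<bar> + \<bar>z\<bar>" "\<bar>z\<bar> \<le> \<bar>x\<bar> + \<bar>y\<bar>"
  shows "\<bar>dunkl_sigma x y z\<bar> \<le> 1"
proof (cases "x = 0 \<or> y = 0")
  case True
  then show ?thesis by (auto simp: dunkl_sigma_def)
next
  case False
  have "\<bar>\<bar>x\<bar> - \<bar>y\<bar>\<bar> \<le> \<bar>z\<bar>" "\<bar>z\<bar> \<le> \<bar>\<bar>x\<bar> + \<bar>y\<bar>\<bar>"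
    using assms by (simp_all add: abs_le_iff[of "\<bar>x\<bar> - \<bar>y\<bar>"])
  then have "(\<bar>x\<bar> - \<bar>y\<bar>)\<^sup>2 \<le> \<bar>z\<bar>\<^sup>2" "\<bar>z\<bar>\<^sup>2 \<le> (\<bar>x\<bar> + \<bar>y\<bar>)\<^sup>2"
    using abs_le_square_iff[of "\<bar>x\<bar> - \<bar>y\<bar>" "\<bar>z\<bar>"] power_mono[of "\<bar>z\<bar>" "\<bar>x\<bar> + \<bar>y\<bar>" 2] by auto
  then have "x\<^sup>2 + y\<^sup>2 - z\<^sup>2 \<le> 2 * \<bar>x\<bar> * \<bar>y\<bar>" "- (x\<^sup>2 + y\<^sup>2 - z\<^sup>2) \<le> 2 * \<bar>x\<bar> * \<bar>y\<bar>"
    by (simp_all add: power2_sum power2_diff)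
  then have "\<bar>x\<^sup>2 + y\<^sup>2 - z\<^sup>2\<bar> \<le> \<bar>2 * x * y\<bar>"
    unfolding abs_mult by (intro abs_leI) simp_all
  then show ?thesis
    using False by (simp add: dunkl_sigma_def abs_mult)
qed

text \<open>On the support of the kernel the absolute values are sides of a triangle, so the
  prefactor is a sum of four terms of size at most 1.\<close>

lemma abs_dunkl_W_le:
  assumes "- 1/2 < \<alpha>"
  shows "\<bar>dunkl_W \<alpha> x y z\<bar> \<le> 4 * dunkl_kappa \<alpha> \<bar>x\<bar> \<bar>y\<bar> \<bar>z\<bar>"
proof (cases "dunkl_kappa \<alpha> \<bar>x\<bar> \<bar>y\<bar> \<bar>z\<bar> = 0")
  case True
  then show ?thesis by (simp add: dunkl_W_def)
next
  case False
  note tri = dunkl_kappa_nonzeroD[OF False]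
  have "\<bar>dunkl_sigma x y z\<bar> \<le> 1" "\<bar>dunkl_sigma z x y\<bar> \<le> 1" "\<bar>dunkl_sigma z y x\<bar> \<le> 1"
    using tri by (auto intro!: dunkl_sigma_le_1)
  then have "\<bar>1 - dunkl_sigma x y z + dunkl_sigma z x y + dunkl_sigma z y x\<bar> \<le> 4"
    by linarith
  then show ?thesis
    using dunkl_kappa_nonneg[OF assms, of "\<bar>x\<bar>" "\<bar>y\<bar>" "\<bar>z\<bar>"]
    by (simp add: dunkl_W_def abs_mult mult_right_mono)
qed

text \<open>Two of the three sigma terms have y in the denominator and are odd in y;
  \<open>dunkl_sigma z x y\<close> sees y only through its square and survives.\<close>

definition dunkl_W_even :: "real \<Rightarrow> real \<Rightarrow> real \<Rightarrow> real \<Rightarrow> real" where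
  "dunkl_W_even \<alpha> x y z = (1 + dunkl_sigma z x y) * dunkl_kappa \<alpha> \<bar>x\<bar> \<bar>y\<bar> \<bar>z\<bar>"

lemma dunkl_W_add_reflect: "dunkl_W \<alpha> x y z + dunkl_W \<alpha> x (- y) z = 2 * dunkl_W_even \<alpha> x y z"
proof -
  have "dunkl_sigma x (- y) z = - dunkl_sigma x y z" "dunkl_sigma z (- y) x = - dunkl_sigma z y x"
    "dunkl_sigma z x (- y) = dunkl_sigma z x y"
    by (auto simp: dunkl_sigma_def)
  then show ?thesis
    by (simp add: dunkl_W_def dunkl_W_even_def algebra_simps)
qed

lemma dunkl_W_even_nonneg:
  assumes "- 1/2 < \<alpha>"
  shows "0 \<le> dunkl_W_even \<alpha> x y z"
proof (cases "dunkl_kappa \<alpha> \<bar>x\<bar> \<bar>y\<bar> \<bar>z\<bar> = 0")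
  case True
  then show ?thesis by (simp add: dunkl_W_even_def)
next
  case False
  have "\<bar>dunkl_sigma z x y\<bar> \<le> 1"
    using dunkl_kappa_nonzeroD[OF False] by (auto intro!: dunkl_sigma_le_1)
  then show ?thesis
    using dunkl_kappa_nonneg[OF assms] by (simp add: dunkl_W_even_def)
qed

lemma power_powr:
  fixes x :: real
  shows "0 < x \<Longrightarrow> (x ^ n) powr e = x powr (real n * e)"
  by (simp add: powr_powr flip: powr_realpow)

text \<open>Counting degrees: the numerator has degree 4 before the power \<alpha> - 1/2, the
  denominator degree 3 before the power 2 \<alpha>, and 4 \<alpha> - 2 - 6 \<alpha> = - d.\<close>

lemma dunkl_kappa_scale:
  assumes "0 < s" "0 \<le> a" "0 \<le> b" "0 \<le> c"
  shows "dunkl_kappa \<alpha> (s * a) (s * b) (s * c) = s powr (- dunkl_dim \<alpha>) * dunkl_kappa \<alpha> a b c"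
proof -
  have cond: "(\<bar>s * a - s * b\<bar> \<le> s * c \<and> s * c \<le> s * a + s * b) = (\<bar>a - b\<bar> \<le> c \<and> c \<le> a + b)"
    using assms by (simp add: abs_mult flip: right_diff_distrib distrib_left)
  have num: "(((s * a + s * b)\<^sup>2 - (s * c)\<^sup>2) * ((s * c)\<^sup>2 - (s * a - s * b)\<^sup>2)) powr (\<alpha> - 1/2)
      = s powr (4 * \<alpha> - 2) * (((a + b)\<^sup>2 - c\<^sup>2) * (c\<^sup>2 - (a - b)\<^sup>2)) powr (\<alpha> - 1/2)"
    if "\<bar>a - b\<bar> \<le> c" "c \<le> a + b"
  proof -
    have "((s * a + s * b)\<^sup>2 - (s * c)\<^sup>2) * ((s * c)\<^sup>2 - (s * a - s * b)\<^sup>2)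
        = s ^ 4 * (((a + b)\<^sup>2 - c\<^sup>2) * (c\<^sup>2 - (a - b)\<^sup>2))"
      by (simp add: algebra_simps power2_eq_square power4_eq_xxxx)
    moreover have "0 \<le> ((a + b)\<^sup>2 - c\<^sup>2) * (c\<^sup>2 - (a - b)\<^sup>2)"
    proof (intro mult_nonneg_nonneg)
      show "0 \<le> (a + b)\<^sup>2 - c\<^sup>2"
        using that assms by (simp add: power_mono)
      show "0 \<le> c\<^sup>2 - (a - b)\<^sup>2"
        using that assms abs_le_square_iff[of "a - b" c] by simp
    qed
    moreover have "(s ^ 4) powr (\<alpha> - 1/2) = s powr (4 * \<alpha> - 2)"
      using assms by (simp add: power_powr algebra_simps)
    ultimately show ?thesis
      using assms by (simp add: powr_mult)
  qed
  have den: "\<bar>s * a * (s * b) * (s * c)\<bar> powr (2 * \<alpha>) = s powr (6 * \<alpha>) * \<bar>a * b * c\<bar> powr (2 * \<alpha>)"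
  proof -
    have "\<bar>s * a * (s * b) * (s * c)\<bar> = s ^ 3 * \<bar>a * b * c\<bar>"
      using assms by (simp add: abs_mult power3_eq_cube)
    moreover have "(s ^ 3) powr (2 * \<alpha>) = s powr (6 * \<alpha>)"
      using assms by (simp add: power_powr algebra_simps)
    ultimately show ?thesis
      using assms by (metis powr_mult)
  qed
  have "s powr (4 * \<alpha> - 2) = s powr (- dunkl_dim \<alpha>) * s powr (6 * \<alpha>)"
    by (simp add: dunkl_dim_def flip: powr_add)
  then show ?thesis
    using assms unfolding dunkl_kappa_def cond den by (auto simp: num)
qed

text \<open>Negative s is included because dilations by t < 0 occur: sigma is a quotient of
  quadratic expressions, so s^2 cancels, and kappa sees absolute values only.\<close>

lemma dunkl_W_even_scale:
  assumes "s \<noteq> 0"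
  shows "dunkl_W_even \<alpha> (s * x) (s * y) (s * z) = \<bar>s\<bar> powr (- dunkl_dim \<alpha>) * dunkl_W_even \<alpha> x y z"
proof -
  have "dunkl_sigma (s * z) (s * x) (s * y) = dunkl_sigma z x y"
  proof -
    have "((s * z)\<^sup>2 + (s * x)\<^sup>2 - (s * y)\<^sup>2) / (2 * (s * z) * (s * x))
       = (s\<^sup>2 * (z\<^sup>2 + x\<^sup>2 - y\<^sup>2)) / (s\<^sup>2 * (2 * z * x))"
      by (rule arg_cong2[where f = "(/)"]) (simp_all add: power2_eq_square algebra_simps)
    then show ?thesis
      using assms by (simp add: dunkl_sigma_def)
  qed
  then show ?thesis
    using assms dunkl_kappa_scale[of "\<bar>s\<bar>" "\<bar>x\<bar>" "\<bar>y\<bar>" "\<bar>z\<bar>" \<alpha>]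
    by (simp add: dunkl_W_even_def abs_mult)
qed

lemma measurable_dunkl_kappa [measurable (raw)]:
  assumes [measurable]: "f \<in> borel_measurable M" "g \<in> borel_measurable M" "h \<in> borel_measurable M"
  shows "(\<lambda>w. dunkl_kappa \<alpha> (f w) (g w) (h w)) \<in> borel_measurable M"
  unfolding dunkl_kappa_def by measurable

lemma measurable_dunkl_sigma [measurable (raw)]:
  assumes [measurable]: "f \<in> borel_measurable M" "g \<in> borel_measurable M" "h \<in> borel_measurable M"
  shows "(\<lambda>w. dunkl_sigma (f w) (g w) (h w)) \<in> borel_measurable M"
  unfolding dunkl_sigma_def by measurable

lemma measurable_dunkl_W [measurable (raw)]:
  assumes [measurable]: "f \<in> borel_measurable M" "g \<in> borel_measurable M" "h \<in> borel_measurable M"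
  shows "(\<lambda>w. dunkl_W \<alpha> (f w) (g w) (h w)) \<in> borel_measurable M"
  unfolding dunkl_W_def by measurable

lemma measurable_dunkl_W_even [measurable (raw)]:
  assumes [measurable]: "f \<in> borel_measurable M" "g \<in> borel_measurable M" "h \<in> borel_measurable M"
  shows "(\<lambda>w. dunkl_W_even \<alpha> (f w) (g w) (h w)) \<in> borel_measurable M"
  unfolding dunkl_W_even_def by measurable

section \<open>The weighted measure on Borel sets and its behaviour under dilation\<close>

lemma sets_dunkl_lborel [measurable_cong, simp]: "sets (dunkl_lborel \<alpha>) = sets borel"
  by (simp add: dunkl_lborel_def)

lemma space_dunkl_lborel [simp]: "space (dunkl_lborel \<alpha>) = UNIV"
  by (simp add: dunkl_lborel_def)

lemma sigma_finite_dunkl_lborel: "sigma_finite_measure (dunkl_lborel \<alpha>)"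
  unfolding dunkl_lborel_def
  by (subst sigma_finite_measure.sigma_finite_iff_density_finite) (auto intro: lborel.sigma_finite_measure_axioms)

lemma nn_integral_dunkl_lborel:
  "h \<in> borel_measurable borel \<Longrightarrow> nn_integral (dunkl_lborel \<alpha>) h
    = (\<integral>\<^sup>+x. ennreal (dunkl_weight \<alpha> x) * h x \<partial>lborel)"
  unfolding dunkl_lborel_def by (subst nn_integral_density) auto

text \<open>The Jacobian contributes |s| and the weight |s| to the power 2 \<alpha> + 1; together
  they give the homogeneous dimension.\<close>

lemma nn_integral_dunkl_lborel_scale:
  assumes [measurable]: "h \<in> borel_measurable borel" and "s \<noteq> 0" "- 1/2 \<le> \<alpha>"
  shows "nn_integral (dunkl_lborel \<alpha>) h
    = ennreal (\<bar>s\<bar> powr dunkl_dim \<alpha>) * (\<integral>\<^sup>+x. h (s * x) \<partial>dunkl_lborel \<alpha>)"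
proof -
  have "nn_integral (dunkl_lborel \<alpha>) h
      = ennreal \<bar>s\<bar> * (\<integral>\<^sup>+x. ennreal (dunkl_weight \<alpha> (s * x)) * h (s * x) \<partial>lborel)"
    by (subst nn_integral_dunkl_lborel, simp, subst nn_integral_real_affine[where c = s and t = 0])
      (use assms in simp_all)
  also have "\<dots> = ennreal \<bar>s\<bar> * (\<integral>\<^sup>+x. ennreal (\<bar>s\<bar> powr (2 * \<alpha> + 1))
      * (ennreal (dunkl_weight \<alpha> x) * h (s * x)) \<partial>lborel)"
    using assms by (simp add: dunkl_weight_mult ennreal_mult dunkl_weight_nonneg mult.assoc)
  also have "\<dots> = ennreal \<bar>s\<bar> * ennreal (\<bar>s\<bar> powr (2 * \<alpha> + 1)) * (\<integral>\<^sup>+x. h (s * x) \<partial>dunkl_lborel \<alpha>)"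
    by (subst nn_integral_cmult) (simp_all add: nn_integral_dunkl_lborel mult.assoc)
  also have "ennreal \<bar>s\<bar> * ennreal (\<bar>s\<bar> powr (2 * \<alpha> + 1)) = ennreal (\<bar>s\<bar> powr dunkl_dim \<alpha>)"
    using assms by (simp add: dunkl_dim_def powr_mult_base add.commute flip: ennreal_mult)
  finally show ?thesis .
qed

section \<open>A bound for the kernel integral over y, uniform in the other two variables\<close>

text \<open>Both Beta parameters are \<alpha> + 1/2, and \<alpha> > -1/2 makes them
  positive.\<close>

lemma nn_integral_Beta_finite:
  assumes "- 1/2 < \<alpha>"
  shows "(\<integral>\<^sup>+s. ennreal ((s * (1 - s)) powr (\<alpha> - 1/2)) * indicator {0..1} s \<partial>lborel) < \<infinity>"
proof -
  have "((\<lambda>s::real. s powr ((\<alpha> + 1/2) - 1) * (1 - s) powr ((\<alpha> + 1/2) - 1)) has_integral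
      Beta (\<alpha> + 1/2) (\<alpha> + 1/2)) {0..1}"
    using assms by (intro has_integral_Beta_real) auto
  then have "(\<integral>\<^sup>+s\<in>{0..1}. ennreal (s powr ((\<alpha> + 1/2) - 1) * (1 - s) powr ((\<alpha> + 1/2) - 1)) \<partial>lborel)
      = ennreal (Beta (\<alpha> + 1/2) (\<alpha> + 1/2))"
    by (intro nn_integral_has_integral_lebesgue') auto
  moreover have "(\<integral>\<^sup>+s\<in>{0..1}. ennreal (s powr ((\<alpha> + 1/2) - 1) * (1 - s) powr ((\<alpha> + 1/2) - 1)) \<partial>lborel)
     = (\<integral>\<^sup>+s. ennreal ((s * (1 - s)) powr (\<alpha> - 1/2)) * indicator {0..1} s \<partial>lborel)"
    by (intro nn_integral_cong) (auto simp: indicator_def powr_mult)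
  ultimately show ?thesis
    by (metis ennreal_less_top infinity_ennreal_def)
qed

text \<open>
  The substitution \<open>s = (y\<^sup>2 - (a - c)\<^sup>2) / (4 a c)\<close> turns the integral of the kernel into a
  Beta integral, which does not depend on \<open>a\<close> and \<open>c\<close>.
\<close>

lemma dunkl_kappa_bounded_half_line:
  assumes "- 1/2 < \<alpha>"
  obtains C :: real where "0 \<le> C"
    "\<And>a c. 0 \<le> a \<Longrightarrow> 0 \<le> c \<Longrightarrow>
      (\<integral>\<^sup>+y. ennreal (y powr (2 * \<alpha> + 1) * dunkl_kappa \<alpha> a y c) * indicator {0<..} y \<partial>lborel) \<le> ennreal C"
proof -
  let ?B = "\<integral>\<^sup>+s. ennreal ((s * (1 - s)) powr (\<alpha> - 1/2)) * indicator {0..1} s \<partial>lborel"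
  \<comment> \<open>The power of 4 comes out of (4 a c)^2 raised to \<alpha> - 1/2. The 2 appears
    because the other powers of a c and y leave y / (a c), twice the derivative of the
    substitution.\<close>
  let ?k = "dunkl_D \<alpha> * 4 powr (2 * \<alpha> - 1) * 2"
  have k: "0 \<le> ?k"
    using dunkl_D_nonneg[OF assms] by simp
  define C where "C = ?k * enn2real ?B"
  show thesis
  proof
    show "0 \<le> C"
      using k by (simp add: C_def)
  next
    fix a c :: real assume ac: "0 \<le> a" "0 \<le> c"
    show "(\<integral>\<^sup>+y. ennreal (y powr (2 * \<alpha> + 1) * dunkl_kappa \<alpha> a y c) * indicator {0<..} y \<partial>lborel) \<le> ennreal C"
    proof (cases "a = 0 \<or> c = 0")
      case True
      \<comment> \<open>A zero side makes the denominator of kappa equal to 0, and division by 0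
        yields 0.\<close>
      then have "dunkl_kappa \<alpha> a y c = 0" for y
        by (auto simp: dunkl_kappa_def)
      then show ?thesis by simp
    next
      case False
      with ac have pos: "0 < a" "0 < c" by auto
      let ?g = "\<lambda>y. (y\<^sup>2 - (a - c)\<^sup>2) / (4 * a * c)"
      let ?g' = "\<lambda>y. y / (2 * a * c)"
      have g0: "?g \<bar>a - c\<bar> = 0" and g1: "?g (a + c) = 1"
        using pos by (auto simp: field_simps power2_eq_square)
      have eq: "ennreal (y powr (2 * \<alpha> + 1) * dunkl_kappa \<alpha> a y c) * indicator {0<..} y
          \<le> ennreal ?k * (ennreal ((?g y * (1 - ?g y)) powr (\<alpha> - 1/2)) * ennreal (?g' y)
              * indicator {\<bar>a - c\<bar>..a + c} y)" for y
      proof (cases "0 < y \<and> y \<in> {\<bar>a - c\<bar>..a + c}")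
        case True
        then have y: "0 < y" "\<bar>a - c\<bar> \<le> y" "y \<le> a + c" by auto
        have tri: "\<bar>a - y\<bar> \<le> c" "c \<le> a + y" using y by auto
        have "0 \<le> ?g y"
          using pos abs_le_square_iff[of "a - c" y] y by (simp add: field_simps)
        moreover have "?g y \<le> 1"
          using pos y power_mono[of y "a + c" 2] by (simp add: field_simps power2_eq_square)
        ultimately have s: "0 \<le> ?g y * (1 - ?g y)"
          by (intro mult_nonneg_nonneg) auto
        \<comment> \<open>By Heron's formula this product is 16 times the squared area of the
          triangle, hence symmetric in the sides. So y and c may trade places, which produces the
          factors (y^2 - (a - c)^2) and ((a + c)^2 - y^2).\<close>
        have "((a + y)\<^sup>2 - c\<^sup>2) * (c\<^sup>2 - (a - y)\<^sup>2) = (4 * a * c)\<^sup>2 * (?g y * (1 - ?g y))"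
        proof -
          have "(4 * a * c)\<^sup>2 * (?g y * (1 - ?g y))
              = (4 * a * c * ?g y) * (4 * a * c * (1 - ?g y))"
            by (simp only: power2_eq_square mult_ac)
          also have "4 * a * c * ?g y = y\<^sup>2 - (a - c)\<^sup>2"
            using pos by simp
          also have "4 * a * c * (1 - ?g y) = 4 * a * c - (y\<^sup>2 - (a - c)\<^sup>2)"
            using pos by (subst right_diff_distrib) simp
          also have "(y\<^sup>2 - (a - c)\<^sup>2) * (4 * a * c - (y\<^sup>2 - (a - c)\<^sup>2))
              = ((a + y)\<^sup>2 - c\<^sup>2) * (c\<^sup>2 - (a - y)\<^sup>2)"
            by (simp add: algebra_simps power2_eq_square)
          finally show ?thesis by simp
        qed
        moreover have "((4 * a * c)\<^sup>2) powr (\<alpha> - 1/2) = 4 powr (2 * \<alpha> - 1) * (a * c) powr (2 * \<alpha> - 1)"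
        proof -
          have "((4 * a * c)\<^sup>2) powr (\<alpha> - 1/2) = (4 * (a * c)) powr (2 * \<alpha> - 1)"
            using pos power_powr[of "4 * a * c" 2 "\<alpha> - 1/2"] by (simp add: right_diff_distrib mult.assoc)
          then show ?thesis
            using pos by (simp add: powr_mult)
        qed
        moreover define S where "S = ?g y * (1 - ?g y)"
        ultimately have num: "(((a + y)\<^sup>2 - c\<^sup>2) * (c\<^sup>2 - (a - y)\<^sup>2)) powr (\<alpha> - 1/2)
            = 4 powr (2 * \<alpha> - 1) * (a * c) powr (2 * \<alpha> - 1) * S powr (\<alpha> - 1/2)"
          by (metis powr_mult)
        have den: "\<bar>a * y * c\<bar> powr (2 * \<alpha>) = (a * c) powr (2 * \<alpha>) * y powr (2 * \<alpha>)"
          using pos y by (simp add: abs_mult powr_mult)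
        have "y powr (2 * \<alpha> + 1) * dunkl_kappa \<alpha> a y c
          = dunkl_D \<alpha> * 4 powr (2 * \<alpha> - 1) * S powr (\<alpha> - 1/2)
              * ((a * c) powr (2 * \<alpha> - 1) / (a * c) powr (2 * \<alpha>))
              * (y powr (2 * \<alpha> + 1) / y powr (2 * \<alpha>))"
          using tri unfolding dunkl_kappa_def num den by simp
        also have "(a * c) powr (2 * \<alpha> - 1) / (a * c) powr (2 * \<alpha>) = 1 / (a * c)"
          using pos by (simp add: powr_diff)
        also have "y powr (2 * \<alpha> + 1) / y powr (2 * \<alpha>) = y"
          using y by (simp add: powr_add)
        finally have "y powr (2 * \<alpha> + 1) * dunkl_kappa \<alpha> a y c = ?k * (S powr (\<alpha> - 1/2) * ?g' y)"
          by simp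
        moreover have "0 \<le> S powr (\<alpha> - 1/2)" "0 \<le> ?g' y"
          using y pos by auto
        ultimately have "ennreal (y powr (2 * \<alpha> + 1) * dunkl_kappa \<alpha> a y c)
            = ennreal ?k * (ennreal (S powr (\<alpha> - 1/2)) * ennreal (?g' y))"
          using k by (metis ennreal_mult mult_nonneg_nonneg)
        then show ?thesis
          using y unfolding S_def by simp
      next
        case False
        moreover have "dunkl_kappa \<alpha> a y c = 0" if "y \<notin> {\<bar>a - c\<bar>..a + c}"
          using that by (auto simp: dunkl_kappa_def)
        ultimately show ?thesis by (auto simp: indicator_def)
      qed
      have "(\<integral>\<^sup>+y. ennreal (y powr (2 * \<alpha> + 1) * dunkl_kappa \<alpha> a y c) * indicator {0<..} y \<partial>lborel)
         \<le> (\<integral>\<^sup>+y. ennreal ?k * (ennreal ((?g y * (1 - ?g y)) powr (\<alpha> - 1/2)) * ennreal (?g' y)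
              * indicator {\<bar>a - c\<bar>..a + c} y) \<partial>lborel)"
        by (intro nn_integral_mono eq)
      also have "\<dots> = ennreal ?k * (\<integral>\<^sup>+y. ennreal ((?g y * (1 - ?g y)) powr (\<alpha> - 1/2)) * ennreal (?g' y)
              * indicator {\<bar>a - c\<bar>..a + c} y \<partial>lborel)"
        by (rule nn_integral_cmult) measurable
      also have "(\<integral>\<^sup>+y. ennreal ((?g y * (1 - ?g y)) powr (\<alpha> - 1/2)) * ennreal (?g' y)
              * indicator {\<bar>a - c\<bar>..a + c} y \<partial>lborel)
          = (\<integral>\<^sup>+s. ennreal ((s * (1 - s)) powr (\<alpha> - 1/2)) * indicator {?g \<bar>a - c\<bar>..?g (a + c)} s \<partial>lborel)"
      proof (rule nn_integral_substitution_aux[symmetric])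
        show "(?g has_real_derivative ?g' y) (at y)" for y
          using pos by (auto intro!: derivative_eq_intros)
        show "continuous_on {\<bar>a - c\<bar>..a + c} ?g'"
          using pos by (intro continuous_intros) auto
        show "\<bar>a - c\<bar> < a + c"
          using pos by auto
        show "0 \<le> ?g' y" if "y \<in> {\<bar>a - c\<bar>..a + c}" for y
          using pos that by auto
        show "(\<lambda>s. ennreal ((s * (1 - s)) powr (\<alpha> - 1/2))) \<in> borel_measurable borel"
          by measurable
      qed simp
      also have "ennreal ?k * \<dots> = ennreal C"
        unfolding g0 g1 C_def using k nn_integral_Beta_finite[OF assms]
        by (simp add: ennreal_mult)
      finally show ?thesis .
    qed
  qed
qed

lemma dunkl_kappa_bounded:
  assumes "- 1/2 < \<alpha>"
  obtains C :: real where "0 \<le> C"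
    "\<And>x z. (\<integral>\<^sup>+y. ennreal (dunkl_kappa \<alpha> \<bar>x\<bar> \<bar>y\<bar> \<bar>z\<bar>) \<partial>dunkl_lborel \<alpha>) \<le> ennreal C"
proof -
  obtain C where C: "0 \<le> C"
    "\<And>a c. 0 \<le> a \<Longrightarrow> 0 \<le> c \<Longrightarrow>
      (\<integral>\<^sup>+y. ennreal (y powr (2 * \<alpha> + 1) * dunkl_kappa \<alpha> a y c) * indicator {0<..} y \<partial>lborel) \<le> ennreal C"
    using dunkl_kappa_bounded_half_line[OF assms] by blast
  let ?c = "inverse (2 powr (\<alpha> + 1) * Gamma (\<alpha> + 1))"
  have c: "0 \<le> ?c"
    using assms by simp
  show thesis
  proof
    show "0 \<le> 2 * ?c * C" using c C(1) by simp
  next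
    fix x z :: real
    let ?h = "\<lambda>y. ennreal (\<bar>y\<bar> powr (2 * \<alpha> + 1) * dunkl_kappa \<alpha> \<bar>x\<bar> \<bar>y\<bar> \<bar>z\<bar>)"
    \<comment> \<open>The point y = 0 belongs to neither half line, but \<open>0 powr _\<close> is
      0, so the integrand vanishes there.\<close>
    have split: "?h y = ?h y * indicator {0<..} y + ?h y * indicator {..<0} y" for y
      by (cases "y < 0"; cases "y = 0") (auto simp: indicator_def)
    have pos: "(\<integral>\<^sup>+y. ?h y * indicator {0<..} y \<partial>lborel) \<le> ennreal C"
    proof -
      have "(\<integral>\<^sup>+y. ?h y * indicator {0<..} y \<partial>lborel)
        = (\<integral>\<^sup>+y. ennreal (y powr (2 * \<alpha> + 1) * dunkl_kappa \<alpha> \<bar>x\<bar> y \<bar>z\<bar>) * indicator {0<..} y \<partial>lborel)"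
        by (intro nn_integral_cong) (auto simp: indicator_def)
      also have "\<dots> \<le> ennreal C" by (intro C(2)) auto
      finally show ?thesis .
    qed
    have neg: "(\<integral>\<^sup>+y. ?h y * indicator {..<0} y \<partial>lborel) = (\<integral>\<^sup>+y. ?h y * indicator {0<..} y \<partial>lborel)"
      by (subst nn_integral_real_affine[where c = "- 1" and t = 0])
        (auto intro!: nn_integral_cong simp: indicator_def)
    have "(\<integral>\<^sup>+y. ?h y \<partial>lborel) = (\<integral>\<^sup>+y. ?h y * indicator {0<..} y + ?h y * indicator {..<0} y \<partial>lborel)"
      by (subst split) (rule refl)
    also have "\<dots> = (\<integral>\<^sup>+y. ?h y * indicator {0<..} y \<partial>lborel) + (\<integral>\<^sup>+y. ?h y * indicator {..<0} y \<partial>lborel)"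
      by (rule nn_integral_add) measurable
    also have "\<dots> \<le> ennreal C + ennreal C"
      unfolding neg using pos by (intro add_mono)
    finally have le: "(\<integral>\<^sup>+y. ?h y \<partial>lborel) \<le> ennreal (2 * C)"
      using C(1) by (simp flip: ennreal_plus)
    have "ennreal (dunkl_weight \<alpha> y) * ennreal (dunkl_kappa \<alpha> \<bar>x\<bar> \<bar>y\<bar> \<bar>z\<bar>) = ennreal ?c * ?h y" for y
    proof -
      have "dunkl_weight \<alpha> y * dunkl_kappa \<alpha> \<bar>x\<bar> \<bar>y\<bar> \<bar>z\<bar>
          = ?c * (\<bar>y\<bar> powr (2 * \<alpha> + 1) * dunkl_kappa \<alpha> \<bar>x\<bar> \<bar>y\<bar> \<bar>z\<bar>)"
        by (simp add: dunkl_weight_def)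
      moreover have "0 \<le> dunkl_weight \<alpha> y" "0 \<le> dunkl_kappa \<alpha> \<bar>x\<bar> \<bar>y\<bar> \<bar>z\<bar>"
        using assms by (auto intro: dunkl_weight_nonneg dunkl_kappa_nonneg)
      ultimately show ?thesis
        using c by (metis ennreal_mult mult_nonneg_nonneg powr_ge_zero)
    qed
    then have "(\<integral>\<^sup>+y. ennreal (dunkl_kappa \<alpha> \<bar>x\<bar> \<bar>y\<bar> \<bar>z\<bar>) \<partial>dunkl_lborel \<alpha>) = (\<integral>\<^sup>+y. ennreal ?c * ?h y \<partial>lborel)"
      by (subst nn_integral_dunkl_lborel) simp_all
    also have "\<dots> = ennreal ?c * (\<integral>\<^sup>+y. ?h y \<partial>lborel)"
      by (rule nn_integral_cmult) measurable
    also have "\<dots> \<le> ennreal ?c * ennreal (2 * C)"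
      by (intro mult_left_mono le) auto
    also have "\<dots> = ennreal (2 * ?c * C)"
      using c C(1) by (simp add: mult_ac flip: ennreal_mult)
    finally show "(\<integral>\<^sup>+y. ennreal (dunkl_kappa \<alpha> \<bar>x\<bar> \<bar>y\<bar> \<bar>z\<bar>) \<partial>dunkl_lborel \<alpha>) \<le> ennreal (2 * ?c * C)" .
  qed
qed

section \<open>Almost everywhere equality and Borel representatives\<close>

lemma pred_in_ball [measurable (raw)]:
  fixes c :: "'a::{metric_space, second_countable_topology}"
  assumes [measurable]: "f \<in> borel_measurable M"
  shows "Measurable.pred M (\<lambda>w. f w \<in> ball c r)" "Measurable.pred M (\<lambda>w. f w \<in> cball c r)"
  unfolding mem_ball mem_cball by measurable

text \<open>P may be a non-measurable predicate, so the change of variables is applied to a Borel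
  null set that contains its exceptions.\<close>

lemma AE_lborel_affine:
  fixes c :: real
  assumes "AE x in lborel. P x" "c \<noteq> 0"
  shows "AE x in lborel. P (t + c * x)"
proof -
  obtain N where N: "N \<in> null_sets lborel" "{x. \<not> P x} \<subseteq> N"
    using assms(1) by (auto simp: eventually_ae_filter)
  then have "AE x in lborel. x \<notin> N" and [measurable]: "N \<in> sets borel"
    using AE_not_in by auto
  then have "AE x in lborel. t + c * x \<notin> N"
    using assms(2) by (intro AE_borel_affine) auto
  then show ?thesis
    by eventually_elim (use N(2) in auto)
qed

text \<open>Completeness of Lebesgue measure: the part of a preimage inside a null set is measurable
  whatever f does there. This serves functions such as the Hausdorff transform that are identified
  only up to null sets.\<close>

lemma borel_measurable_lebesgue_AE_eq:
  fixes f :: "real \<Rightarrow> 'a::topological_space"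
  assumes [measurable]: "g \<in> borel_measurable borel" and "AE x in lborel. f x = g x"
  shows "f \<in> borel_measurable lebesgue"
proof -
  obtain N where N: "N \<in> null_sets lborel" "{x. f x \<noteq> g x} \<subseteq> N"
    using assms(2) by (auto simp: eventually_ae_filter)
  show ?thesis
  proof (rule measurableI)
    fix A :: "'a set" assume A: "A \<in> sets borel"
    have "f -` A = (g -` A - N) \<union> (f -` A \<inter> N)"
      using N(2) by auto
    moreover have "f -` A \<inter> N \<in> sets lebesgue"
      using N(1) by (intro null_sets_completion[of N]) auto
    moreover have "g -` A - N \<in> sets lebesgue"
      using N(1) A measurable_sets[OF assms(1) A] by (intro sets_completionI_sets) auto
    ultimately have "f -` A \<in> sets lebesgue"
      by (metis sets.Un)
    then show "f -` A \<inter> space lebesgue \<in> sets lebesgue"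
      by simp
  qed simp
qed

lemma integral_dunkl_measure_eq:
  fixes f :: "real \<Rightarrow> 'a::{banach, second_countable_topology}"
  assumes [measurable]: "g \<in> borel_measurable borel" and "AE x in lborel. f x = g x" and "- 1/2 \<le> \<alpha>"
  shows "integral\<^sup>L (dunkl_measure \<alpha>) f = integral\<^sup>L (dunkl_lborel \<alpha>) g"
proof -
  have f [measurable]: "f \<in> borel_measurable lebesgue"
    using borel_measurable_lebesgue_AE_eq[OF assms(1,2)] .
  have w: "dunkl_weight \<alpha> \<in> borel_measurable lebesgue"
    by (intro measurable_completion) simp
  have "integral\<^sup>L (dunkl_measure \<alpha>) f = (LINT x|lebesgue. dunkl_weight \<alpha> x *\<^sub>R f x)"
    unfolding dunkl_measure_eq using w assms(3)
    by (intro integral_density) (auto simp: dunkl_weight_nonneg)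
  also have "\<dots> = (LINT x|lebesgue. dunkl_weight \<alpha> x *\<^sub>R g x)"
  proof (intro integral_cong_AE)
    show "AE x in lebesgue. dunkl_weight \<alpha> x *\<^sub>R f x = dunkl_weight \<alpha> x *\<^sub>R g x"
      using AE_completion[OF assms(2)] by eventually_elim simp
    show "(\<lambda>x. dunkl_weight \<alpha> x *\<^sub>R g x) \<in> borel_measurable lebesgue"
      by (intro measurable_completion) simp
  qed (use w in measurable)
  also have "\<dots> = (LINT x|lborel. dunkl_weight \<alpha> x *\<^sub>R g x)"
    by (rule integral_completion) measurable
  also have "\<dots> = integral\<^sup>L (dunkl_lborel \<alpha>) g"
    unfolding dunkl_lborel_def using assms(3)
    by (intro integral_density[symmetric]) (auto simp: dunkl_weight_nonneg)
  finally show ?thesis .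
qed

lemma nn_integral_dunkl_measure_eq:
  fixes f :: "real \<Rightarrow> ennreal"
  assumes [measurable]: "g \<in> borel_measurable borel" and "AE x in lborel. f x = g x"
  shows "integral\<^sup>N (dunkl_measure \<alpha>) f = integral\<^sup>N (dunkl_lborel \<alpha>) g"
proof -
  have "f \<in> borel_measurable lebesgue"
    using borel_measurable_lebesgue_AE_eq[OF assms(1,2)] .
  moreover have w: "dunkl_weight \<alpha> \<in> borel_measurable lebesgue"
    by (intro measurable_completion) simp
  ultimately have "integral\<^sup>N (dunkl_measure \<alpha>) f = (\<integral>\<^sup>+x. ennreal (dunkl_weight \<alpha> x) * f x \<partial>lebesgue)"
    unfolding dunkl_measure_eq by (intro nn_integral_density) auto
  also have "\<dots> = (\<integral>\<^sup>+x. ennreal (dunkl_weight \<alpha> x) * f x \<partial>lborel)"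
    by (rule nn_integral_completion)
  also have "\<dots> = (\<integral>\<^sup>+x. ennreal (dunkl_weight \<alpha> x) * g x \<partial>lborel)"
    using assms(2) by (intro nn_integral_cong_AE) (auto elim: eventually_mono)
  finally show ?thesis
    by (simp add: nn_integral_dunkl_lborel)
qed

lemma integral_dunkl_lborel_uminus:
  fixes h :: "real \<Rightarrow> real"
  assumes [measurable]: "h \<in> borel_measurable borel" and "- 1/2 \<le> \<alpha>"
  shows "(LINT y|dunkl_lborel \<alpha>. h (- y)) = integral\<^sup>L (dunkl_lborel \<alpha>) h"
proof -
  have eq: "integral\<^sup>L (dunkl_lborel \<alpha>) k = (LINT x|lborel. dunkl_weight \<alpha> x *\<^sub>R k x)"
    if [measurable]: "k \<in> borel_measurable borel" for k :: "real \<Rightarrow> real"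
    unfolding dunkl_lborel_def using assms(2)
    by (intro integral_density) (auto simp: dunkl_weight_nonneg)
  have "dunkl_weight \<alpha> (- x) = dunkl_weight \<alpha> x" for x
    by (simp add: dunkl_weight_def)
  then show ?thesis
    by (subst (1 2) eq, simp, simp, subst (2) lborel_integral_real_affine[where c = "- 1" and t = 0]) auto
qed

section \<open>The ball kernel and the translation integrated over a ball\<close>

text \<open>In the classical theory this is the translate by -x of the indicator of B(0, r), the
  dual side of the translation. The case x = 0 needs its own clause: there kappa is 0 through
  division by 0, and the Dirac mass would be lost.\<close>

definition dunkl_ball_kernel :: "real \<Rightarrow> real \<Rightarrow> real \<Rightarrow> real \<Rightarrow> ennreal" where
  "dunkl_ball_kernel \<alpha> x r z =
     (if \<alpha> = - 1/2 then indicator (ball x r) z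
      else if x = 0 then indicator (ball 0 r) z
      else \<integral>\<^sup>+y. indicator (ball 0 r) y * ennreal (dunkl_W_even \<alpha> x y z) \<partial>dunkl_lborel \<alpha>)"

lemma measurable_dunkl_ball_kernel [measurable]: "dunkl_ball_kernel \<alpha> x r \<in> borel_measurable borel"
proof -
  interpret sigma_finite_measure "dunkl_lborel \<alpha>"
    by (rule sigma_finite_dunkl_lborel)
  show ?thesis
    by (cases "\<alpha> = - 1/2"; cases "x = 0") (simp_all add: dunkl_ball_kernel_def[abs_def])
qed

text \<open>Substituting s y for y produces |s|^d, which cancels the degree - d of the kernel; the
  ball shrinks to radius r / |s|.\<close>

lemma dunkl_ball_kernel_scale:
  assumes "s \<noteq> 0" "- 1/2 \<le> \<alpha>"
  shows "dunkl_ball_kernel \<alpha> x r (s * z) = dunkl_ball_kernel \<alpha> (x / s) (r / \<bar>s\<bar>) z"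
proof -
  have ball: "s * y \<in> ball (s * w) r \<longleftrightarrow> y \<in> ball w (r / \<bar>s\<bar>)" for w y
  proof -
    have "dist (s * w) (s * y) = \<bar>s\<bar> * dist w y"
      by (simp add: dist_real_def abs_mult flip: right_diff_distrib)
    then show ?thesis
      using assms(1) by (simp add: pos_less_divide_eq mult.commute)
  qed
  consider "\<alpha> = - 1/2" | "\<alpha> \<noteq> - 1/2" "x = 0" | "\<alpha> \<noteq> - 1/2" "x \<noteq> 0"
    by blast
  then show ?thesis
  proof cases
    case 1
    then show ?thesis
      using ball[of z "x / s"] assms(1) by (simp add: dunkl_ball_kernel_def indicator_def)
  next
    case 2
    then show ?thesis
      using ball[of z 0] assms(1) by (simp add: dunkl_ball_kernel_def indicator_def)
  next
    case 3
    have "dunkl_ball_kernel \<alpha> x r (s * z)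
        = (\<integral>\<^sup>+y. indicator (ball 0 r) y * ennreal (dunkl_W_even \<alpha> x y (s * z)) \<partial>dunkl_lborel \<alpha>)"
      using 3 by (simp add: dunkl_ball_kernel_def)
    also have "\<dots> = ennreal (\<bar>s\<bar> powr dunkl_dim \<alpha>) *
        (\<integral>\<^sup>+y. indicator (ball 0 r) (s * y) * ennreal (dunkl_W_even \<alpha> x (s * y) (s * z)) \<partial>dunkl_lborel \<alpha>)"
      by (rule nn_integral_dunkl_lborel_scale) (use assms in auto)
    also have "\<dots> = (\<integral>\<^sup>+y. ennreal (\<bar>s\<bar> powr dunkl_dim \<alpha>) *
        (indicator (ball 0 r) (s * y) * ennreal (dunkl_W_even \<alpha> x (s * y) (s * z))) \<partial>dunkl_lborel \<alpha>)"
      by (rule nn_integral_cmult[symmetric]) measurable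
    also have "\<dots> = (\<integral>\<^sup>+y. indicator (ball 0 (r / \<bar>s\<bar>)) y * ennreal (dunkl_W_even \<alpha> (x / s) y z) \<partial>dunkl_lborel \<alpha>)"
    proof (rule nn_integral_cong)
      fix y
      have "\<bar>s\<bar> powr dunkl_dim \<alpha> * dunkl_W_even \<alpha> x (s * y) (s * z) = dunkl_W_even \<alpha> (x / s) y z"
        using dunkl_W_even_scale[OF assms(1), of \<alpha> "x / s" y z] assms(1)
        by (simp add: powr_minus)
      then have "ennreal (\<bar>s\<bar> powr dunkl_dim \<alpha>) * ennreal (dunkl_W_even \<alpha> x (s * y) (s * z))
          = ennreal (dunkl_W_even \<alpha> (x / s) y z)"
        by (metis ennreal_mult' powr_ge_zero)
      moreover have "indicator (ball 0 r) (s * y) = (indicator (ball 0 (r / \<bar>s\<bar>)) y :: ennreal)"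
        using ball[of y 0] by (simp add: indicator_def)
      ultimately show "ennreal (\<bar>s\<bar> powr dunkl_dim \<alpha>) *
            (indicator (ball 0 r) (s * y) * ennreal (dunkl_W_even \<alpha> x (s * y) (s * z)))
          = indicator (ball 0 (r / \<bar>s\<bar>)) y * ennreal (dunkl_W_even \<alpha> (x / s) y z)"
        by (metis mult.left_commute)
    qed
    also have "\<dots> = dunkl_ball_kernel \<alpha> (x / s) (r / \<bar>s\<bar>) z"
      using 3 assms(1) by (simp add: dunkl_ball_kernel_def)
    finally show ?thesis .
  qed
qed

text \<open>V will be the kernel and its reflection in y. Integrating over y first leaves a constant
  independent of z, and the support of kappa confines z to |z| \<le> |x| + r, where g has finite
  integral.\<close>

lemma integrable_kappa_dominated:
  fixes g :: "real \<Rightarrow> real" and V :: "real \<Rightarrow> real \<Rightarrow> real"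
  assumes "- 1/2 < \<alpha>" and [measurable]: "g \<in> borel_measurable borel"
    and [measurable]: "(\<lambda>(y, z). V y z) \<in> borel_measurable (borel \<Otimes>\<^sub>M borel)"
    and g_nonneg: "\<And>z. 0 \<le> g z"
    and g_finite: "\<And>R. (\<integral>\<^sup>+z. ennreal (g z) * indicator (cball 0 R) z \<partial>dunkl_lborel \<alpha>) < \<infinity>"
    and V: "\<And>y z. \<bar>V y z\<bar> \<le> 4 * dunkl_kappa \<alpha> \<bar>x\<bar> \<bar>y\<bar> \<bar>z\<bar>"
  shows "integrable (dunkl_lborel \<alpha> \<Otimes>\<^sub>M dunkl_lborel \<alpha>)
           (\<lambda>(y, z). indicator (ball 0 r) y * (V y z * g z))"
proof (rule integrableI_bounded)
  let ?M = "dunkl_lborel \<alpha>"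
  interpret M: sigma_finite_measure ?M
    by (rule sigma_finite_dunkl_lborel)
  interpret pair_sigma_finite ?M ?M ..
  have [measurable]: "(\<lambda>w. V (fst w) (snd w)) \<in> borel_measurable (?M \<Otimes>\<^sub>M ?M)"
    using assms(3) by (simp add: case_prod_unfold cong: measurable_cong_sets sets_pair_measure_cong)
  show [measurable]: "(\<lambda>(y, z). indicator (ball 0 r) y * (V y z * g z)) \<in> borel_measurable (?M \<Otimes>\<^sub>M ?M)"
    by measurable
  obtain C where C: "0 \<le> C"
    "\<And>x z. (\<integral>\<^sup>+y. ennreal (dunkl_kappa \<alpha> \<bar>x\<bar> \<bar>y\<bar> \<bar>z\<bar>) \<partial>?M) \<le> ennreal C"
    using dunkl_kappa_bounded[OF assms(1)] by blast
  have le: "ennreal (norm (indicator (ball 0 r) y * (V y z * g z)))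
      \<le> ennreal 4 * (ennreal (g z) * indicator (cball 0 (\<bar>x\<bar> + r)) z) * ennreal (dunkl_kappa \<alpha> \<bar>x\<bar> \<bar>y\<bar> \<bar>z\<bar>)" for y z
  proof (cases "y \<in> ball 0 r \<and> dunkl_kappa \<alpha> \<bar>x\<bar> \<bar>y\<bar> \<bar>z\<bar> \<noteq> 0")
    case True
    then have "z \<in> cball 0 (\<bar>x\<bar> + r)"
      using dunkl_kappa_nonzeroD(3)[of \<alpha> x y z] by auto
    moreover have "norm (indicator (ball 0 r) y * (V y z * g z)) \<le> 4 * g z * dunkl_kappa \<alpha> \<bar>x\<bar> \<bar>y\<bar> \<bar>z\<bar>"
      using mult_right_mono[OF V[of y z] g_nonneg[of z]] True g_nonneg[of z] by (simp add: abs_mult mult_ac)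
    ultimately show ?thesis
      using g_nonneg[of z] dunkl_kappa_nonneg[OF assms(1), of "\<bar>x\<bar>" "\<bar>y\<bar>" "\<bar>z\<bar>"]
      by (simp add: ennreal_mult[symmetric] ennreal_leI del: ennreal_numeral)
  next
    case False
    then have "indicator (ball 0 r) y * (V y z * g z) = 0"
      using V[of y z] by (auto simp: indicator_def)
    then show ?thesis
      by (simp only: norm_zero ennreal_0 zero_le)
  qed
  have "(\<integral>\<^sup>+w. ennreal (norm (case w of (y, z) \<Rightarrow> indicator (ball 0 r) y * (V y z * g z))) \<partial>(?M \<Otimes>\<^sub>M ?M))
      = (\<integral>\<^sup>+z. \<integral>\<^sup>+y. ennreal (norm (indicator (ball 0 r) y * (V y z * g z))) \<partial>?M \<partial>?M)"
    by (subst nn_integral_snd[symmetric]) auto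
  also have "\<dots> \<le> (\<integral>\<^sup>+z. \<integral>\<^sup>+y. ennreal 4 * (ennreal (g z) * indicator (cball 0 (\<bar>x\<bar> + r)) z)
        * ennreal (dunkl_kappa \<alpha> \<bar>x\<bar> \<bar>y\<bar> \<bar>z\<bar>) \<partial>?M \<partial>?M)"
    by (intro nn_integral_mono le)
  also have "\<dots> = (\<integral>\<^sup>+z. ennreal 4 * (ennreal (g z) * indicator (cball 0 (\<bar>x\<bar> + r)) z)
        * (\<integral>\<^sup>+y. ennreal (dunkl_kappa \<alpha> \<bar>x\<bar> \<bar>y\<bar> \<bar>z\<bar>) \<partial>?M) \<partial>?M)"
    by (intro nn_integral_cong nn_integral_cmult) measurable
  also have "\<dots> \<le> (\<integral>\<^sup>+z. ennreal 4 * (ennreal (g z) * indicator (cball 0 (\<bar>x\<bar> + r)) z) * ennreal C \<partial>?M)"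
    by (intro nn_integral_mono mult_left_mono C(2)) auto
  also have "\<dots> = ennreal 4 * (\<integral>\<^sup>+z. ennreal (g z) * indicator (cball 0 (\<bar>x\<bar> + r)) z \<partial>?M) * ennreal C"
    by (subst nn_integral_multc, measurable, subst nn_integral_cmult) auto
  also have "\<dots> < \<infinity>"
    using g_finite[of "\<bar>x\<bar> + r"] by (simp add: ennreal_mult_less_top)
  finally show "(\<integral>\<^sup>+w. ennreal (norm (case w of (y, z) \<Rightarrow> indicator (ball 0 r) y * (V y z * g z))) \<partial>(?M \<Otimes>\<^sub>M ?M)) < \<infinity>" .
qed

text \<open>
  Averaging over the reflection \<open>y \<mapsto> - y\<close> replaces the signed kernel by its nonnegative even part.
\<close>

lemma dunkl_W_ball_integral:
  fixes g :: "real \<Rightarrow> real"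
  assumes "- 1/2 < \<alpha>" "x \<noteq> 0" and [measurable]: "g \<in> borel_measurable borel"
    and g_nonneg: "\<And>z. 0 \<le> g z"
    and g_finite: "\<And>R. (\<integral>\<^sup>+z. ennreal (g z) * indicator (cball 0 R) z \<partial>dunkl_lborel \<alpha>) < \<infinity>"
  shows "(\<integral>\<^sup>+z. ennreal (g z) * dunkl_ball_kernel \<alpha> x r z \<partial>dunkl_lborel \<alpha>) < \<infinity>"
    and "(LINT y|dunkl_lborel \<alpha>. indicator (ball 0 r) y * (LINT z|dunkl_lborel \<alpha>. dunkl_W \<alpha> x y z * g z))
      = enn2real (\<integral>\<^sup>+z. ennreal (g z) * dunkl_ball_kernel \<alpha> x r z \<partial>dunkl_lborel \<alpha>)"
proof -
  let ?M = "dunkl_lborel \<alpha>"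
  interpret M: sigma_finite_measure ?M
    by (rule sigma_finite_dunkl_lborel)
  interpret pair_sigma_finite ?M ?M ..
  define F where "F = (\<lambda>y z. indicator (ball 0 r) y * (dunkl_W \<alpha> x y z * g z))"
  define E where "E = (\<lambda>y z. indicator (ball 0 r) y * (dunkl_W_even \<alpha> x y z * g z))"
  have F [measurable]: "(\<lambda>(y, z). F y z) \<in> borel_measurable (borel \<Otimes>\<^sub>M borel)"
    unfolding F_def by measurable
  have E [measurable]: "(\<lambda>(y, z). E y z) \<in> borel_measurable (borel \<Otimes>\<^sub>M borel)"
    unfolding E_def by measurable
  have int_F: "integrable (?M \<Otimes>\<^sub>M ?M) (\<lambda>(y, z). F y z)"
    unfolding F_def
    by (rule integrable_kappa_dominated[OF assms(1,3) _ g_nonneg g_finite abs_dunkl_W_le[OF assms(1)]]) measurable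
  have ind: "indicator (ball 0 r) (- y) = (indicator (ball 0 r) y :: real)" for y :: real
    by (simp add: indicator_def)
  have F_reflect: "F (- y) z = indicator (ball 0 r) y * (dunkl_W \<alpha> x (- y) z * g z)" for y z
    unfolding F_def by (metis ind)
  have "\<bar>dunkl_W \<alpha> x (- y) z\<bar> \<le> 4 * dunkl_kappa \<alpha> \<bar>x\<bar> \<bar>y\<bar> \<bar>z\<bar>" for y z
    using abs_dunkl_W_le[OF assms(1), of x "- y" z] by simp
  then have "integrable (?M \<Otimes>\<^sub>M ?M) (\<lambda>(y, z). indicator (ball 0 r) y * (dunkl_W \<alpha> x (- y) z * g z))"
    by (intro integrable_kappa_dominated[OF assms(1,3) _ g_nonneg g_finite]) measurable
  then have int_F': "integrable (?M \<Otimes>\<^sub>M ?M) (\<lambda>(y, z). F (- y) z)"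
    by (simp add: F_reflect)
  have FE: "F y z + F (- y) z = 2 * E y z" for y z
  proof -
    have "F y z + F (- y) z = indicator (ball 0 r) y * ((dunkl_W \<alpha> x y z + dunkl_W \<alpha> x (- y) z) * g z)"
      unfolding F_reflect by (simp add: F_def algebra_simps)
    then show ?thesis
      by (simp add: dunkl_W_add_reflect E_def)
  qed
  then have E_eq: "(\<lambda>(y, z). E y z) = (\<lambda>w. ((case w of (y, z) \<Rightarrow> F y z) + (case w of (y, z) \<Rightarrow> F (- y) z)) / 2)"
    by (auto simp: fun_eq_iff)
  have int_E: "integrable (?M \<Otimes>\<^sub>M ?M) (\<lambda>(y, z). E y z)"
    unfolding E_eq using int_F int_F' by (intro Bochner_Integration.integrable_divide Bochner_Integration.integrable_add)
  let ?T = "\<lambda>y. LINT z|?M. F y z"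
  have T [measurable]: "?T \<in> borel_measurable borel"
  proof -
    have "?T \<in> borel_measurable ?M"
      using M.borel_measurable_lebesgue_integral[of "F" ?M] by measurable
    then show ?thesis by simp
  qed
  have IF: "integral\<^sup>L (?M \<Otimes>\<^sub>M ?M) (\<lambda>(y, z). F y z) = integral\<^sup>L ?M ?T"
    using integral_fst[OF int_F] by simp
  \<comment> \<open>Here the inner integral is \<open>?T\<close> at - y. The weight is even, so
    reflecting the outer variable changes nothing, and the average E inherits the same
    integral.\<close>
  have IF': "integral\<^sup>L (?M \<Otimes>\<^sub>M ?M) (\<lambda>(y, z). F (- y) z) = integral\<^sup>L ?M ?T"
    using integral_fst[OF int_F'] integral_dunkl_lborel_uminus[OF T, of \<alpha>] assms(1) by simp
  have IE: "integral\<^sup>L (?M \<Otimes>\<^sub>M ?M) (\<lambda>(y, z). E y z) = integral\<^sup>L ?M ?T"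
    unfolding E_eq using int_F int_F' by (simp add: IF IF')
  have E_nonneg: "0 \<le> E y z" for y z
    using dunkl_W_even_nonneg[OF assms(1)] g_nonneg by (simp add: E_def)
  have NE: "(\<integral>\<^sup>+w. ennreal (case w of (y, z) \<Rightarrow> E y z) \<partial>(?M \<Otimes>\<^sub>M ?M))
      = (\<integral>\<^sup>+z. ennreal (g z) * dunkl_ball_kernel \<alpha> x r z \<partial>?M)"
  proof -
    have "(\<integral>\<^sup>+w. ennreal (case w of (y, z) \<Rightarrow> E y z) \<partial>(?M \<Otimes>\<^sub>M ?M)) = (\<integral>\<^sup>+z. \<integral>\<^sup>+y. ennreal (E y z) \<partial>?M \<partial>?M)"
      by (subst nn_integral_snd[symmetric]) auto
    also have "\<dots> = (\<integral>\<^sup>+z. \<integral>\<^sup>+y. ennreal (g z) * (indicator (ball 0 r) y * ennreal (dunkl_W_even \<alpha> x y z)) \<partial>?M \<partial>?M)"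
      using dunkl_W_even_nonneg[OF assms(1)] g_nonneg
      by (intro nn_integral_cong) (auto simp: E_def indicator_def ennreal_mult mult.commute)
    also have "\<dots> = (\<integral>\<^sup>+z. ennreal (g z) * dunkl_ball_kernel \<alpha> x r z \<partial>?M)"
      using assms(1,2) by (simp add: dunkl_ball_kernel_def nn_integral_cmult)
    finally show ?thesis .
  qed
  have "(\<integral>\<^sup>+w. ennreal (norm (case w of (y, z) \<Rightarrow> E y z)) \<partial>(?M \<Otimes>\<^sub>M ?M)) < \<infinity>"
    using int_E by (simp add: integrable_iff_bounded)
  then show "(\<integral>\<^sup>+z. ennreal (g z) * dunkl_ball_kernel \<alpha> x r z \<partial>?M) < \<infinity>"
    using E_nonneg unfolding NE[symmetric] by (simp add: case_prod_unfold)
  have "integral\<^sup>L (?M \<Otimes>\<^sub>M ?M) (\<lambda>(y, z). E y z)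
      = enn2real (\<integral>\<^sup>+w. ennreal (case w of (y, z) \<Rightarrow> E y z) \<partial>(?M \<Otimes>\<^sub>M ?M))"
    using E_nonneg int_E by (intro integral_eq_nn_integral) auto
  then show "(LINT y|?M. indicator (ball 0 r) y * (LINT z|?M. dunkl_W \<alpha> x y z * g z))
      = enn2real (\<integral>\<^sup>+z. ennreal (g z) * dunkl_ball_kernel \<alpha> x r z \<partial>?M)"
    unfolding NE IE by (simp add: F_def)
qed

text \<open>The bridge from the Morrey norm to the ball kernel, for f known only up to a null set.
  Finiteness accompanies the formula because \<open>enn2real\<close> would hide an infinite
  value.\<close>

lemma set_integral_dunkl_translation:
  fixes f g :: "real \<Rightarrow> real"
  assumes "- 1/2 \<le> \<alpha>" and [measurable]: "g \<in> borel_measurable borel" and fg: "AE z in lborel. f z = g z"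
    and g_nonneg: "\<And>z. 0 \<le> g z"
    and g_finite: "\<And>R. (\<integral>\<^sup>+z. ennreal (g z) * indicator (cball 0 R) z \<partial>dunkl_lborel \<alpha>) < \<infinity>"
  shows "(\<integral>\<^sup>+z. ennreal (g z) * dunkl_ball_kernel \<alpha> x r z \<partial>dunkl_lborel \<alpha>) < \<infinity>" (is ?fin)
    and "(LINT y:ball 0 r|dunkl_measure \<alpha>. dunkl_translation \<alpha> x f y)
      = enn2real (\<integral>\<^sup>+z. ennreal (g z) * dunkl_ball_kernel \<alpha> x r z \<partial>dunkl_lborel \<alpha>)" (is ?int)
proof -
  let ?M = "dunkl_lborel \<alpha>"
  have ball_case: "(\<integral>\<^sup>+z. ennreal (g z) * indicator (ball w r) z \<partial>?M) < \<infinity>" for w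
  proof -
    have "(\<integral>\<^sup>+z. ennreal (g z) * indicator (ball w r) z \<partial>?M)
        \<le> (\<integral>\<^sup>+z. ennreal (g z) * indicator (cball 0 (\<bar>w\<bar> + r)) z \<partial>?M)"
      by (intro nn_integral_mono) (auto simp: indicator_def dist_real_def)
    then show ?thesis
      using g_finite[of "\<bar>w\<bar> + r"] by (rule le_less_trans)
  qed
  have lint: "(LINT z|?M. indicator (ball w r) z * g z)
      = enn2real (\<integral>\<^sup>+z. ennreal (g z) * indicator (ball w r) z \<partial>?M)" for w
  proof -
    have "(LINT z|?M. indicator (ball w r) z * g z) = enn2real (\<integral>\<^sup>+z. ennreal (indicator (ball w r) z * g z) \<partial>?M)"
      using g_nonneg by (intro integral_eq_nn_integral) auto
    also have "(\<integral>\<^sup>+z. ennreal (indicator (ball w r) z * g z) \<partial>?M) = (\<integral>\<^sup>+z. ennreal (g z) * indicator (ball w r) z \<partial>?M)"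
      by (intro nn_integral_cong) (auto simp: indicator_def)
    finally show ?thesis .
  qed
  have nz: "AE y::real in lborel. y \<noteq> 0"
    by (rule AE_lborel_singleton)
  consider "\<alpha> = - 1/2" | "- 1/2 < \<alpha>" "x = 0" | "- 1/2 < \<alpha>" "x \<noteq> 0"
    using assms(1) by linarith
  then have "?fin \<and> ?int"
  proof cases
    case 1
    have "(LINT y:ball 0 r|dunkl_measure \<alpha>. dunkl_translation \<alpha> x f y)
        = (LINT y|?M. indicator (ball 0 r) y * g (x + y))"
      unfolding set_lebesgue_integral_def
    proof (rule integral_dunkl_measure_eq)
      have "AE y in lborel. f (x + y) = g (x + y)"
        using AE_lborel_affine[OF fg, of 1 x] by simp
      then show "AE y in lborel. indicator (ball 0 r) y *\<^sub>R dunkl_translation \<alpha> x f y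
          = indicator (ball 0 r) y * g (x + y)"
        by eventually_elim (use 1 in \<open>simp add: dunkl_translation_def\<close>)
    qed (use assms(1) in auto)
    also have "\<dots> = (LINT y|lborel. dunkl_weight \<alpha> y *\<^sub>R (indicator (ball 0 r) y * g (x + y)))"
      unfolding dunkl_lborel_def using assms(1) by (intro integral_density) (auto simp: dunkl_weight_nonneg)
    also have "\<dots> = (LINT y|lborel. dunkl_weight \<alpha> (x + y) *\<^sub>R (indicator (ball x r) (x + y) * g (x + y)))"
    proof (intro integral_cong_AE)
      \<comment> \<open>For \<alpha> = -1/2 the weight is constant except at the origin, where
        \<open>0 powr 0\<close> is 0. Translation invariance can therefore fail only at y = 0 and y
        = - x, both negligible.\<close>
      have "AE y in lborel. y \<noteq> - x"
        by (rule AE_lborel_singleton)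
      with nz show "AE y in lborel. dunkl_weight \<alpha> y *\<^sub>R (indicator (ball 0 r) y * g (x + y))
          = dunkl_weight \<alpha> (x + y) *\<^sub>R (indicator (ball x r) (x + y) * g (x + y))"
        by eventually_elim (use 1 in \<open>auto simp: dunkl_weight_def indicator_def dist_real_def\<close>)
    qed measurable
    also have "\<dots> = (LINT y|lborel. dunkl_weight \<alpha> y *\<^sub>R (indicator (ball x r) y * g y))"
      by (subst (2) lborel_integral_real_affine[where c = 1 and t = x]) simp_all
    also have "\<dots> = (LINT y|?M. indicator (ball x r) y * g y)"
      unfolding dunkl_lborel_def using assms(1)
      by (intro integral_density[symmetric]) (auto simp: dunkl_weight_nonneg)
    finally show ?thesis
      using 1 ball_case lint by (simp add: dunkl_ball_kernel_def)
  next
    case 2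
    then have tr: "dunkl_translation \<alpha> x f y = f y" for y
      by (simp add: dunkl_translation_def)
    have "(LINT y:ball 0 r|dunkl_measure \<alpha>. dunkl_translation \<alpha> x f y) = (LINT y|?M. indicator (ball 0 r) y * g y)"
      unfolding set_lebesgue_integral_def
    proof (rule integral_dunkl_measure_eq)
      show "AE y in lborel. indicator (ball 0 r) y *\<^sub>R dunkl_translation \<alpha> x f y = indicator (ball 0 r) y * g y"
        using fg by eventually_elim (simp add: tr)
    qed (use assms(1) in auto)
    then show ?thesis
      using 2 ball_case lint by (simp add: dunkl_ball_kernel_def)
  next
    case 3
    interpret M: sigma_finite_measure ?M
      by (rule sigma_finite_dunkl_lborel)
    \<comment> \<open>The point y = 0 follows the Dirac clause instead and is discarded below as a
      null set.\<close>
    have tr: "dunkl_translation \<alpha> x f y = (LINT z|?M. dunkl_W \<alpha> x y z * g z)" if "y \<noteq> 0" for y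
    proof -
      have "dunkl_translation \<alpha> x f y = (LINT z|dunkl_measure \<alpha>. dunkl_W \<alpha> x y z *\<^sub>R f z)"
        using 3 that by (simp add: dunkl_translation_def)
      also have "\<dots> = (LINT z|?M. dunkl_W \<alpha> x y z * g z)"
      proof (rule integral_dunkl_measure_eq)
        show "AE z in lborel. dunkl_W \<alpha> x y z *\<^sub>R f z = dunkl_W \<alpha> x y z * g z"
          using fg by eventually_elim simp
      qed (use assms(1) in auto)
      finally show ?thesis .
    qed
    have "(LINT y:ball 0 r|dunkl_measure \<alpha>. dunkl_translation \<alpha> x f y)
        = (LINT y|?M. indicator (ball 0 r) y * (LINT z|?M. dunkl_W \<alpha> x y z * g z))"
      unfolding set_lebesgue_integral_def
    proof (rule integral_dunkl_measure_eq)
      show "AE y in lborel. indicator (ball 0 r) y *\<^sub>R dunkl_translation \<alpha> x f y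
          = indicator (ball 0 r) y * (LINT z|?M. dunkl_W \<alpha> x y z * g z)"
        using nz by eventually_elim (simp add: tr)
      show "(\<lambda>y. indicator (ball 0 r) y * (LINT z|?M. dunkl_W \<alpha> x y z * g z)) \<in> borel_measurable borel"
        by measurable
    qed (use assms(1) in auto)
    then show ?thesis
      using dunkl_W_ball_integral[OF 3 assms(2) g_nonneg g_finite] by simp
  qed
  then show ?fin ?int by auto
qed

section \<open>Young's and Jensen's inequalities\<close>

text \<open>The convex function u^p lies above its tangent at l; solved for u, this is the claim,
  with equality at u = l. The conjugate exponent p / (p - 1) used in the proof forces p = 1 to be
  separate.\<close>

lemma Young_one:
  fixes p u l :: real
  assumes "1 \<le> p" "0 \<le> u" "0 < l"
  shows "u \<le> l powr (1 - p) / p * u powr p + l * (1 - 1 / p)"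
proof (cases "p = 1")
  case True
  then show ?thesis using assms by (cases "u = 0") auto
next
  case False
  then have p: "1 < p" using assms by simp
  have "u / l * 1 \<le> (u / l) powr p / p + 1 powr (p / (p - 1)) / (p / (p - 1))"
    using p assms by (intro Youngs_inequality) (auto simp: field_simps)
  then have "l * (u / l) \<le> l * ((u / l) powr p / p + (1 - 1 / p))"
    using p assms by (intro mult_left_mono) (auto simp: field_simps)
  also have "l * ((u / l) powr p / p + (1 - 1 / p)) = l powr (1 - p) / p * u powr p + l * (1 - 1 / p)"
    using assms by (simp add: powr_divide powr_diff distrib_left)
  finally show ?thesis using assms by simp
qed

text \<open>
  Jensen's inequality for the weight \<open>m\<close>.  Here it replaces Minkowski's integral inequality, because
  the norms of the dilates of \<open>f\<close> are known up to a power of the dilation parameter.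
\<close>

lemma nn_integral_Jensen_powr:
  fixes m u :: "'a \<Rightarrow> real"
  assumes [measurable]: "m \<in> borel_measurable M" "u \<in> borel_measurable M"
    and nonneg: "\<And>t. 0 \<le> m t" "\<And>t. 0 \<le> u t" and p: "1 \<le> p"
    and K: "(\<integral>\<^sup>+t. ennreal (m t) \<partial>M) = ennreal K" "0 \<le> K"
  shows "(\<integral>\<^sup>+t. ennreal (m t * u t powr p) \<partial>M) < \<infinity> \<Longrightarrow> (\<integral>\<^sup>+t. ennreal (m t * u t) \<partial>M) < \<infinity>"
    and "ennreal (enn2real (\<integral>\<^sup>+t. ennreal (m t * u t) \<partial>M) powr p)
      \<le> ennreal (K powr (p - 1)) * (\<integral>\<^sup>+t. ennreal (m t * u t powr p) \<partial>M)"
proof -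
  let ?A = "\<integral>\<^sup>+t. ennreal (m t * u t) \<partial>M"
  let ?B = "\<integral>\<^sup>+t. ennreal (m t * u t powr p) \<partial>M"
  \<comment> \<open>Integrating the tangent inequality against m gives one linear bound for each l;
    l stays free until it can be optimised.\<close>
  have bound: "?A \<le> ennreal (l powr (1 - p) / p) * ?B + ennreal (l * (1 - 1 / p)) * ennreal K" if "0 < l" for l
  proof -
    have c: "0 \<le> l powr (1 - p) / p" "0 \<le> l * (1 - 1 / p)"
      using p that by auto
    have "?A \<le> (\<integral>\<^sup>+t. ennreal (l powr (1 - p) / p) * ennreal (m t * u t powr p)
        + ennreal (l * (1 - 1 / p)) * ennreal (m t) \<partial>M)"
    proof (intro nn_integral_mono)
      fix t
      have "m t * u t \<le> m t * (l powr (1 - p) / p * u t powr p + l * (1 - 1 / p))"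
        using Young_one[OF p nonneg(2)[of t] that] nonneg(1)[of t] by (rule mult_left_mono)
      also have "\<dots> = (l powr (1 - p) / p) * (m t * u t powr p) + (l * (1 - 1 / p)) * m t"
        by (simp add: distrib_left mult_ac)
      finally have "ennreal (m t * u t)
          \<le> ennreal ((l powr (1 - p) / p) * (m t * u t powr p) + (l * (1 - 1 / p)) * m t)"
        by (rule ennreal_leI)
      also have "\<dots> = ennreal ((l powr (1 - p) / p) * (m t * u t powr p)) + ennreal ((l * (1 - 1 / p)) * m t)"
        using mult_nonneg_nonneg[OF c(1), of "m t * u t powr p"] mult_nonneg_nonneg[OF c(2) nonneg(1)[of t]]
          nonneg(1)[of t] by (intro ennreal_plus) auto
      also have "\<dots> = ennreal (l powr (1 - p) / p) * ennreal (m t * u t powr p)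
        + ennreal (l * (1 - 1 / p)) * ennreal (m t)"
        using c by (simp only: ennreal_mult')
      finally show "ennreal (m t * u t) \<le> \<dots>" .
    qed
    also have "\<dots> = ennreal (l powr (1 - p) / p) * ?B + ennreal (l * (1 - 1 / p)) * ennreal K"
      by (simp add: nn_integral_add nn_integral_cmult K(1))
    finally show ?thesis .
  qed
  show fin: "?A < \<infinity>" if "?B < \<infinity>"
    by (rule le_less_trans[OF bound[of 1]]) (use that in \<open>auto simp: ennreal_mult_less_top\<close>)
  have zero: "?A = 0" if "AE t in M. m t = 0 \<or> u t = 0"
  proof -
    have "?A = (\<integral>\<^sup>+t. 0 \<partial>M)"
      by (intro nn_integral_cong_AE) (use that in eventually_elim, auto)
    then show ?thesis by simp
  qed
  have K0: "?A = 0" if "K = 0"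
  proof (rule zero)
    have "AE t in M. ennreal (m t) = 0"
      using K(1) that by (subst nn_integral_0_iff_AE[symmetric]) auto
    then show "AE t in M. m t = 0 \<or> u t = 0"
      by eventually_elim (use nonneg in \<open>auto simp: ennreal_eq_0_iff intro: antisym\<close>)
  qed
  have B0: "?A = 0" if "?B = 0"
  proof (rule zero)
    have "AE t in M. ennreal (m t * u t powr p) = 0"
      using that by (subst nn_integral_0_iff_AE[symmetric]) auto
    then show "AE t in M. m t = 0 \<or> u t = 0"
    proof eventually_elim
      case (elim t)
      then have "m t * u t powr p \<le> 0" by (simp add: ennreal_eq_0_iff)
      moreover have "0 \<le> m t * u t powr p" using nonneg by simp
      ultimately show ?case by auto
    qed
  qed
  show "ennreal (enn2real ?A powr p) \<le> ennreal (K powr (p - 1)) * ?B"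
  \<comment> \<open>The optimal l is a power of the quotient of \<open>?B\<close> by K and must be
    positive, so the degenerate cases are settled first by \<open>?A\<close> = 0.\<close>
  proof (cases "K = 0 \<or> ?B = 0")
    case True
    then show ?thesis using K0 B0 by auto
  next
    case False
    then have K_pos: "0 < K" using K(2) by simp
    show ?thesis
    proof (cases "?B")
      case top
      then show ?thesis using K_pos by (simp add: ennreal_mult_top)
    next
      case (real b)
      then have b: "0 < b" using False by (cases "b = 0") auto
      \<comment> \<open>This is the p-th power mean of u for the weight m. With it the two summands
        of the bound become l K / p and l K (1 - 1/p), which add up to l K.\<close>
      define l where "l = (b / K) powr (1 / p)"
      have l: "0 < l" "l powr p = b / K"
        using b K_pos p by (auto simp: l_def powr_powr)
      have "?A \<le> ennreal (l powr (1 - p) / p) * ennreal b + ennreal (l * (1 - 1 / p)) * ennreal K"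
        using bound[OF l(1)] real by simp
      also have "\<dots> = ennreal (l powr (1 - p) / p * b + l * (1 - 1 / p) * K)"
      proof -
        have "0 \<le> l powr (1 - p) / p" "0 \<le> l * (1 - 1 / p)"
          using p l by auto
        then show ?thesis
          using b K_pos by (simp only: ennreal_mult'[symmetric] ennreal_plus[symmetric] mult_nonneg_nonneg less_imp_le)
      qed
      also have "l powr (1 - p) / p * b + l * (1 - 1 / p) * K = l * K"
      proof -
        have "l powr (1 - p) = l * K / b"
          using b K_pos l by (simp add: powr_diff)
        then show ?thesis
          using b p by (simp add: field_simps)
      qed
      finally have "enn2real ?A \<le> l * K"
        using l K_pos by (intro enn2real_leI) auto
      then have "enn2real ?A powr p \<le> (l * K) powr p"
        using p by (intro powr_mono2) auto
      also have "\<dots> = b / K * K powr p"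
        using l by (simp add: powr_mult)
      also have "\<dots> = K powr (p - 1) * b"
        using K_pos by (simp add: powr_diff)
      finally show ?thesis
        using b by (simp add: real ennreal_leI flip: ennreal_mult)
    qed
  qed
qed

section \<open>Inversion of null sets and Borel representatives\<close>

text \<open>For x \<noteq> 0 the map t to x / t is its own inverse off 0, so the bad t form the
  image of a null set under a map differentiable there, and such images are null.\<close>

lemma AE_lborel_divide:
  fixes x :: real
  assumes "x \<noteq> 0" "AE u in lborel. P u"
  shows "AE t in lborel. P (x / t)"
proof -
  obtain N where N: "N \<in> null_sets lborel" "{u. \<not> P u} \<subseteq> N"
    using assms(2) by (auto simp: eventually_ae_filter)
  then have "negligible N"
    by (simp add: negligible_iff_null_sets null_sets_completionI)
  then have "negligible (N - {0})"
    by (rule negligible_diff)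
  moreover have "(\<lambda>t. x / t) differentiable_on (N - {0})"
    by (auto simp: differentiable_on_def intro!: differentiable_divide)
  ultimately have "negligible ((\<lambda>t. x / t) ` (N - {0}))"
    by (intro negligible_differentiable_image_negligible) auto
  then have "AE t in lebesgue. t \<notin> (\<lambda>t. x / t) ` (N - {0})"
    by (intro AE_not_in) (simp add: negligible_iff_null_sets)
  then have "AE t in lborel. t \<notin> (\<lambda>t. x / t) ` (N - {0})"
    by (simp add: AE_completion_iff)
  moreover have "AE t::real in lborel. t \<noteq> 0"
    by (rule AE_lborel_singleton)
  ultimately show ?thesis
  proof eventually_elim
    case (elim t)
    have "t = x / (x / t)" "x / t \<noteq> 0"
      using elim(2) assms(1) by auto
    then have "x / t \<notin> N"
      using elim(1) by blast
    then show ?case using N(2) by auto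
  qed
qed

lemma lebesgue_borel_representative:
  fixes f :: "real \<Rightarrow> complex"
  assumes "f \<in> borel_measurable lebesgue"
  obtains g where "g \<in> borel_measurable borel" "AE x in lborel. f x = g x"
proof -
  have "(\<lambda>x. Re (f x)) \<in> borel_measurable lebesgue" "(\<lambda>x. Im (f x)) \<in> borel_measurable lebesgue"
    using assms by measurable
  then obtain a b where [measurable]: "a \<in> borel_measurable lborel" "b \<in> borel_measurable lborel"
    and ab: "AE x in lborel. Re (f x) = a x" "AE x in lborel. Im (f x) = b x"
    using completion_ex_borel_measurable_real by metis
  show thesis
  proof
    show "(\<lambda>x. of_real (a x) + \<i> * of_real (b x)) \<in> borel_measurable borel"
      by measurable
    show "AE x in lborel. f x = of_real (a x) + \<i> * of_real (b x)"
      using ab by eventually_elim (metis complex_eq)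
  qed
qed

text \<open>The weight is positive off the origin, so the return to Lebesgue measure costs a single
  point.\<close>

lemma AE_of_AE_dunkl_lborel:
  assumes "AE x in dunkl_lborel \<alpha>. P x" "- 1/2 \<le> \<alpha>"
  shows "AE x in lborel. P x"
proof -
  have "AE x in lborel. 0 < ennreal (dunkl_weight \<alpha> x) \<longrightarrow> P x"
    using assms(1) unfolding dunkl_lborel_def by (subst (asm) AE_density) auto
  moreover have "AE x::real in lborel. x \<noteq> 0"
    by (rule AE_lborel_singleton)
  ultimately show ?thesis
  proof eventually_elim
    case (elim x)
    then have "0 < dunkl_weight \<alpha> x"
      using assms(2) by (auto simp: dunkl_weight_def intro!: mult_pos_pos)
    then show ?case using elim by simp
  qed
qed

section \<open>The Hausdorff integrand as weight times normalised dilate\<close>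

definition hausdorff_weight :: "real \<Rightarrow> real \<Rightarrow> (real \<Rightarrow> complex) \<Rightarrow> real \<Rightarrow> real" where
  "hausdorff_weight \<alpha> q \<psi> t = norm (\<psi> t) / \<bar>t\<bar> powr (dunkl_dim \<alpha> * (1 - 1 / q))"

lemma hausdorff_weight_nonneg: "0 \<le> hausdorff_weight \<alpha> q \<psi> t"
  by (simp add: hausdorff_weight_def)

lemma hausdorff_const_eq: "hausdorff_const \<alpha> q \<psi> = (\<integral>\<^sup>+t. ennreal (hausdorff_weight \<alpha> q \<psi> t) \<partial>lborel)"
  by (simp add: hausdorff_const_def hausdorff_weight_def nn_integral_completion)

lemma measurable_hausdorff_weight [measurable]:
  assumes [measurable]: "\<psi> \<in> borel_measurable borel"
  shows "hausdorff_weight \<alpha> q \<psi> \<in> borel_measurable borel"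
  unfolding hausdorff_weight_def[abs_def] by measurable

text \<open>The exponents d (1 - 1/q) and d/q add up to d. At t = 0 both sides vanish through
  \<open>0 powr _\<close> = 0 and division by 0.\<close>

lemma norm_hausdorff_integrand:
  "norm (hausdorff_integrand \<alpha> \<psi> f x t)
    = hausdorff_weight \<alpha> q \<psi> t * (\<bar>t\<bar> powr (- dunkl_dim \<alpha> / q) * norm (f (x / t)))"
proof -
  have "\<bar>t\<bar> powr (- dunkl_dim \<alpha> / q) / \<bar>t\<bar> powr (dunkl_dim \<alpha> * (1 - 1 / q)) = 1 / \<bar>t\<bar> powr (2 * \<alpha> + 2)"
  proof (cases "t = 0")
    case False
    have "\<bar>t\<bar> powr (- dunkl_dim \<alpha> / q) / \<bar>t\<bar> powr (dunkl_dim \<alpha> * (1 - 1 / q))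
        = \<bar>t\<bar> powr (- dunkl_dim \<alpha> / q - dunkl_dim \<alpha> * (1 - 1 / q))"
      by (simp add: powr_diff)
    also have "- dunkl_dim \<alpha> / q - dunkl_dim \<alpha> * (1 - 1 / q) = - dunkl_dim \<alpha>"
      by (simp add: right_diff_distrib)
    finally show ?thesis
      by (simp only: powr_minus_divide dunkl_dim_def)
  qed simp
  then have "norm (\<psi> t) * (\<bar>t\<bar> powr (- dunkl_dim \<alpha> / q) / \<bar>t\<bar> powr (dunkl_dim \<alpha> * (1 - 1 / q))) * norm (f (x / t))
      = norm (\<psi> t) * (1 / \<bar>t\<bar> powr (2 * \<alpha> + 2)) * norm (f (x / t))"
    by simp
  then show ?thesis
    by (simp add: hausdorff_integrand_def hausdorff_weight_def norm_mult norm_divide)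
qed

lemma dunkl_ball_kernel_zero: "dunkl_ball_kernel \<alpha> 0 r = indicator (ball 0 r)"
  by (auto simp: dunkl_ball_kernel_def)

section \<open>The estimate for Borel data\<close>

text \<open>Assumption \<open>morrey\<close> is the Morrey bound solved for its integral I: r^(d/q)
  (r^(-d) I)^(1/p) \<le> c becomes I \<le> c^p r^(d - d p/q). Hence N stands for the p-th power of
  the norm of f.\<close>

locale hausdorff_setting =
  fixes \<alpha> p q :: real and \<psi> f :: "real \<Rightarrow> complex" and K N :: real
  assumes alpha: "- 1/2 \<le> \<alpha>" and p: "1 \<le> p" and N: "0 \<le> N" and K: "0 \<le> K"
    and borel [measurable]: "\<psi> \<in> borel_measurable borel" "f \<in> borel_measurable borel"
    and const: "hausdorff_const \<alpha> q \<psi> = ennreal K"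
    and morrey: "\<And>x r. 0 < r \<Longrightarrow>
      (\<integral>\<^sup>+z. ennreal (norm (f z) powr p) * dunkl_ball_kernel \<alpha> x r z \<partial>dunkl_lborel \<alpha>)
        \<le> ennreal (N * r powr (dunkl_dim \<alpha> - dunkl_dim \<alpha> * p / q))"
begin

abbreviation m :: "real \<Rightarrow> real" where "m \<equiv> hausdorff_weight \<alpha> q \<psi>"

text \<open>The dilate of f by t, scaled so that its Morrey bound does not depend on t.\<close>

definition u :: "real \<Rightarrow> real \<Rightarrow> real" where
  "u x t = \<bar>t\<bar> powr (- dunkl_dim \<alpha> / q) * norm (f (x / t))"

definition jensen_bound :: "real \<Rightarrow> ennreal" where
  "jensen_bound x = (\<integral>\<^sup>+t. ennreal (m t * u x t powr p) \<partial>lborel)"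

lemma measurable_u [measurable (raw)]:
  assumes [measurable]: "a \<in> borel_measurable M" "b \<in> borel_measurable M"
  shows "(\<lambda>w. u (a w) (b w)) \<in> borel_measurable M"
  unfolding u_def by measurable

lemma u_nonneg: "0 \<le> u x t"
  by (simp add: u_def)

lemma measurable_jensen_bound [measurable]: "jensen_bound \<in> borel_measurable borel"
  unfolding jensen_bound_def[abs_def] by measurable

text \<open>Substituting t z for z moves the dilation into centre and radius of the ball, and the
  Morrey bound covers all of these at once. The powers of |t| are d, - d p/q and - (d - d p/q), with
  sum 0.\<close>

lemma dilate_bound:
  assumes "0 < r" "t \<noteq> 0"
  shows "(\<integral>\<^sup>+z. ennreal (u z t powr p) * dunkl_ball_kernel \<alpha> x r z \<partial>dunkl_lborel \<alpha>)
    \<le> ennreal (N * r powr (dunkl_dim \<alpha> - dunkl_dim \<alpha> * p / q))"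
proof -
  let ?d = "dunkl_dim \<alpha>" and ?e = "dunkl_dim \<alpha> - dunkl_dim \<alpha> * p / q"
  let ?c = "\<bar>t\<bar> powr (- ?d * p / q)"
  have ut: "u (t * z) t powr p = ?c * norm (f z) powr p" for z
    using assms by (simp add: u_def powr_mult powr_powr mult.commute)
  have "(\<integral>\<^sup>+z. ennreal (u z t powr p) * dunkl_ball_kernel \<alpha> x r z \<partial>dunkl_lborel \<alpha>)
      = ennreal (\<bar>t\<bar> powr ?d) * (\<integral>\<^sup>+z. ennreal (u (t * z) t powr p) * dunkl_ball_kernel \<alpha> x r (t * z) \<partial>dunkl_lborel \<alpha>)"
    by (rule nn_integral_dunkl_lborel_scale) (use assms alpha in auto)
  also have "\<dots> = ennreal (\<bar>t\<bar> powr ?d) * (\<integral>\<^sup>+z. ennreal ?c *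
      (ennreal (norm (f z) powr p) * dunkl_ball_kernel \<alpha> (x / t) (r / \<bar>t\<bar>) z) \<partial>dunkl_lborel \<alpha>)"
    using assms alpha by (simp add: dunkl_ball_kernel_scale ut ennreal_mult mult.assoc)
  also have "\<dots> = ennreal (\<bar>t\<bar> powr ?d) * (ennreal ?c *
      (\<integral>\<^sup>+z. ennreal (norm (f z) powr p) * dunkl_ball_kernel \<alpha> (x / t) (r / \<bar>t\<bar>) z \<partial>dunkl_lborel \<alpha>))"
    by (subst nn_integral_cmult) auto
  also have "\<dots> \<le> ennreal (\<bar>t\<bar> powr ?d) * (ennreal ?c * ennreal (N * (r / \<bar>t\<bar>) powr ?e))"
    using assms by (intro mult_left_mono morrey) auto
  also have "\<dots> = ennreal (\<bar>t\<bar> powr ?d * (?c * (N * (r / \<bar>t\<bar>) powr ?e)))"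
    using N by (simp add: ennreal_mult)
  also have "\<bar>t\<bar> powr ?d * (?c * (N * (r / \<bar>t\<bar>) powr ?e)) = N * r powr ?e"
  proof -
    have "\<bar>t\<bar> powr ?d * ?c = \<bar>t\<bar> powr ?e"
      by (simp flip: powr_add)
    moreover have "(r / \<bar>t\<bar>) powr ?e = r powr ?e / \<bar>t\<bar> powr ?e"
      using assms by (simp add: powr_divide)
    ultimately show ?thesis
      using assms by (simp add: mult.assoc[symmetric])
  qed
  finally show ?thesis .
qed

text \<open>Tonelli brings the z-integral inside, where its bound is the same for all t; what
  remains is the mass K of m.\<close>

lemma jensen_bound_integral:
  assumes "0 < r"
  shows "(\<integral>\<^sup>+z. jensen_bound z * dunkl_ball_kernel \<alpha> x r z \<partial>dunkl_lborel \<alpha>)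
    \<le> ennreal K * ennreal (N * r powr (dunkl_dim \<alpha> - dunkl_dim \<alpha> * p / q))"
proof -
  let ?R = "ennreal (N * r powr (dunkl_dim \<alpha> - dunkl_dim \<alpha> * p / q))"
  interpret M: sigma_finite_measure "dunkl_lborel \<alpha>"
    by (rule sigma_finite_dunkl_lborel)
  interpret pair_sigma_finite lborel "dunkl_lborel \<alpha>" ..
  have "(\<integral>\<^sup>+z. jensen_bound z * dunkl_ball_kernel \<alpha> x r z \<partial>dunkl_lborel \<alpha>)
      = (\<integral>\<^sup>+z. \<integral>\<^sup>+t. ennreal (m t * u z t powr p) * dunkl_ball_kernel \<alpha> x r z \<partial>lborel \<partial>dunkl_lborel \<alpha>)"
    unfolding jensen_bound_def by (intro nn_integral_cong nn_integral_multc[symmetric]) measurable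
  also have "\<dots> = (\<integral>\<^sup>+t. \<integral>\<^sup>+z. ennreal (m t * u z t powr p) * dunkl_ball_kernel \<alpha> x r z \<partial>dunkl_lborel \<alpha> \<partial>lborel)"
    by (rule Fubini') measurable
  also have "\<dots> = (\<integral>\<^sup>+t. ennreal (m t) * (\<integral>\<^sup>+z. ennreal (u z t powr p) * dunkl_ball_kernel \<alpha> x r z \<partial>dunkl_lborel \<alpha>) \<partial>lborel)"
    by (subst nn_integral_cmult[symmetric]) (auto simp: ennreal_mult hausdorff_weight_nonneg mult.assoc)
  also have "\<dots> \<le> (\<integral>\<^sup>+t. ennreal (m t) * ?R \<partial>lborel)"
  proof (intro nn_integral_mono)
    fix t
    show "ennreal (m t) * (\<integral>\<^sup>+z. ennreal (u z t powr p) * dunkl_ball_kernel \<alpha> x r z \<partial>dunkl_lborel \<alpha>)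
        \<le> ennreal (m t) * ?R"
    proof (cases "t = 0")
      case True
      \<comment> \<open>Dilation by 0 is meaningless, but the weight vanishes there through division
        by \<open>0 powr _\<close>.\<close>
      then have "m t = 0" by (simp add: hausdorff_weight_def)
      then show ?thesis by simp
    next
      case False
      then show ?thesis
        using assms by (intro mult_left_mono dilate_bound) auto
    qed
  qed
  also have "\<dots> = ennreal K * ?R"
    by (simp add: nn_integral_multc const[unfolded hausdorff_const_eq])
  finally show ?thesis .
qed

text \<open>At centre 0 the ball kernel is an indicator, so the preceding bound gives finite
  integrals over balls, and countably many balls exhaust the line. \<open>Suc n\<close> keeps the
  radii positive.\<close>

lemma AE_jensen_bound_finite: "AE x in lborel. jensen_bound x < \<infinity>"
proof -
  have "AE x in dunkl_lborel \<alpha>. \<forall>n. jensen_bound x * indicator (ball 0 (real (Suc n))) x \<noteq> \<infinity>"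
    unfolding AE_all_countable
  proof
    fix n
    have "(\<integral>\<^sup>+z. jensen_bound z * indicator (ball 0 (real (Suc n))) z \<partial>dunkl_lborel \<alpha>) < \<infinity>"
      using jensen_bound_integral[of "real (Suc n)" 0]
      by (auto simp: dunkl_ball_kernel_zero ennreal_mult_less_top elim!: le_less_trans)
    then show "AE x in dunkl_lborel \<alpha>. jensen_bound x * indicator (ball 0 (real (Suc n))) x \<noteq> \<infinity>"
      by (intro nn_integral_noteq_infinite) auto
  qed
  then have "AE x in dunkl_lborel \<alpha>. jensen_bound x < \<infinity>"
  proof eventually_elim
    case (elim x)
    obtain n where "\<bar>x\<bar> < real n"
      using reals_Archimedean2 by blast
    then have "x \<in> ball 0 (real (Suc n))" by auto
    then show ?case using elim[rule_format, of n] by (simp add: less_top)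
  qed
  then show ?thesis
    using alpha by (rule AE_of_AE_dunkl_lborel)
qed

lemma hausdorff_measurable [measurable]:
  "(\<lambda>x. LINT t|lborel. hausdorff_integrand \<alpha> \<psi> f x t) \<in> borel_measurable borel"
  unfolding hausdorff_integrand_def by measurable

lemma integrand_measurable [measurable]: "hausdorff_integrand \<alpha> \<psi> f x \<in> borel_measurable borel"
  unfolding hausdorff_integrand_def[abs_def] by measurable

lemma nn_integral_norm_integrand:
  "(\<integral>\<^sup>+t. ennreal (norm (hausdorff_integrand \<alpha> \<psi> f x t)) \<partial>lborel) = (\<integral>\<^sup>+t. ennreal (m t * u x t) \<partial>lborel)"
  by (simp add: norm_hausdorff_integrand[where q = q] u_def)

lemma weight_integral: "(\<integral>\<^sup>+t. ennreal (m t) \<partial>lborel) = ennreal K"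
  using const by (simp add: hausdorff_const_eq)

lemma AE_integrable: "AE x in lborel. integrable lborel (hausdorff_integrand \<alpha> \<psi> f x)"
  using AE_jensen_bound_finite
proof eventually_elim
  case (elim x)
  have "(\<integral>\<^sup>+t. ennreal (m t * u x t) \<partial>lborel) < \<infinity>"
    using elim unfolding jensen_bound_def
    by (intro nn_integral_Jensen_powr(1)[OF _ _ hausdorff_weight_nonneg u_nonneg p weight_integral K]) auto
  then show ?case
    by (simp add: integrable_iff_bounded nn_integral_norm_integrand)
qed

text \<open>True at every x: where the integrand is not integrable, the Bochner integral and
  \<open>enn2real\<close> of the infinite integral are both 0.\<close>

lemma norm_hausdorff_powr_le:
  "ennreal (norm (LINT t|lborel. hausdorff_integrand \<alpha> \<psi> f x t) powr p) \<le> ennreal (K powr (p - 1)) * jensen_bound x"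
proof -
  have "norm (LINT t|lborel. hausdorff_integrand \<alpha> \<psi> f x t) \<le> (LINT t|lborel. norm (hausdorff_integrand \<alpha> \<psi> f x t))"
    by (rule integral_norm_bound)
  also have "\<dots> = enn2real (\<integral>\<^sup>+t. ennreal (m t * u x t) \<partial>lborel)"
    by (subst integral_eq_nn_integral) (auto simp: nn_integral_norm_integrand)
  finally have "ennreal (norm (LINT t|lborel. hausdorff_integrand \<alpha> \<psi> f x t) powr p)
      \<le> ennreal (enn2real (\<integral>\<^sup>+t. ennreal (m t * u x t) \<partial>lborel) powr p)"
    using p by (intro ennreal_leI powr_mono2) auto
  also have "\<dots> \<le> ennreal (K powr (p - 1)) * jensen_bound x"
    unfolding jensen_bound_def
    by (intro nn_integral_Jensen_powr(2)[OF _ _ hausdorff_weight_nonneg u_nonneg p weight_integral K]) auto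
  finally show ?thesis .
qed

lemma hausdorff_ball_bound:
  assumes "0 < r"
  shows "(\<integral>\<^sup>+z. ennreal (norm (LINT t|lborel. hausdorff_integrand \<alpha> \<psi> f z t) powr p)
      * dunkl_ball_kernel \<alpha> x r z \<partial>dunkl_lborel \<alpha>)
    \<le> ennreal (K powr p * N * r powr (dunkl_dim \<alpha> - dunkl_dim \<alpha> * p / q))"
proof -
  let ?R = "N * r powr (dunkl_dim \<alpha> - dunkl_dim \<alpha> * p / q)"
  have "(\<integral>\<^sup>+z. ennreal (norm (LINT t|lborel. hausdorff_integrand \<alpha> \<psi> f z t) powr p)
      * dunkl_ball_kernel \<alpha> x r z \<partial>dunkl_lborel \<alpha>)
    \<le> (\<integral>\<^sup>+z. ennreal (K powr (p - 1)) * (jensen_bound z * dunkl_ball_kernel \<alpha> x r z) \<partial>dunkl_lborel \<alpha>)"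
    unfolding mult.assoc[symmetric]
    by (intro nn_integral_mono mult_right_mono norm_hausdorff_powr_le) auto
  also have "\<dots> = ennreal (K powr (p - 1)) * (\<integral>\<^sup>+z. jensen_bound z * dunkl_ball_kernel \<alpha> x r z \<partial>dunkl_lborel \<alpha>)"
    by (rule nn_integral_cmult) measurable
  also have "\<dots> \<le> ennreal (K powr (p - 1)) * (ennreal K * ennreal ?R)"
    by (intro mult_left_mono jensen_bound_integral assms) auto
  also have "\<dots> = ennreal (K powr (p - 1) * K * ?R)"
    using K N by (simp add: ennreal_mult mult.assoc)
  \<comment> \<open>K = 0 is split off because \<open>powr_diff\<close> turns the left side into a
    quotient by K.\<close>
  also have "K powr (p - 1) * K = K powr p"
    using K by (cases "K = 0") (auto simp: powr_diff)
  finally show ?thesis by (simp add: mult.assoc)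
qed

end

section \<open>Transfer to Lebesgue measurable data\<close>

theorem theorem3p2:
  fixes \<alpha> p q :: real and \<psi> f :: "real \<Rightarrow> complex"
  assumes "- 1/2 \<le> \<alpha>" and "1 \<le> p" and "p \<le> q"
    and "\<psi> \<in> borel_measurable lebesgue"
    and "hausdorff_const \<alpha> q \<psi> < \<infinity>"
    and "f \<in> dunkl_morrey \<alpha> p q"
  shows "(AE x in lebesgue. integrable lebesgue (hausdorff_integrand \<alpha> \<psi> f x))
    \<and> dunkl_hausdorff \<alpha> \<psi> f \<in> dunkl_morrey \<alpha> p q
    \<and> dunkl_morrey_norm \<alpha> p q (dunkl_hausdorff \<alpha> \<psi> f)
        \<le> hausdorff_const \<alpha> q \<psi> * dunkl_morrey_norm \<alpha> p q f"
proof -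
  let ?d = "dunkl_dim \<alpha>"
  have p: "0 < p" using assms(2) by simp
  have f_local: "locally_p_integrable \<alpha> p f" and f_norm: "dunkl_morrey_norm \<alpha> p q f < \<infinity>"
    using assms(6) by (auto simp: dunkl_morrey_def)
  obtain f' where f' [measurable]: "f' \<in> borel_measurable borel" and ff': "AE x in lborel. f x = f' x"
    using lebesgue_borel_representative f_local unfolding locally_p_integrable_def by blast
  obtain \<psi>' where \<psi>' [measurable]: "\<psi>' \<in> borel_measurable borel" and \<psi>\<psi>': "AE x in lborel. \<psi> x = \<psi>' x"
    using lebesgue_borel_representative[OF assms(4)] by blast
  define K where "K = enn2real (hausdorff_const \<alpha> q \<psi>)"
  have K: "0 \<le> K" "hausdorff_const \<alpha> q \<psi> = ennreal K"
    using assms(5) by (auto simp: K_def)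
  have "hausdorff_const \<alpha> q \<psi>' = hausdorff_const \<alpha> q \<psi>"
    unfolding hausdorff_const_eq
    by (intro nn_integral_cong_AE) (use \<psi>\<psi>' in eventually_elim, simp add: hausdorff_weight_def)
  with K have K': "hausdorff_const \<alpha> q \<psi>' = ennreal K" by simp
  define N where "N = enn2real (dunkl_morrey_norm \<alpha> p q f)"
  have N: "0 \<le> N" "dunkl_morrey_norm \<alpha> p q f = ennreal N"
    using f_norm by (auto simp: N_def)

  have f_finite: "(\<integral>\<^sup>+z. ennreal (norm (f' z) powr p) * indicator (cball 0 R) z \<partial>dunkl_lborel \<alpha>) < \<infinity>" for R
  proof -
    have "set_integrable (dunkl_measure \<alpha>) (cball 0 R) (\<lambda>x. norm (f x) powr p)"
      using f_local by (auto simp: locally_p_integrable_def)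
    then have "(\<integral>\<^sup>+x. ennreal (norm (indicator (cball 0 R) x *\<^sub>R (norm (f x) powr p))) \<partial>dunkl_measure \<alpha>) < \<infinity>"
      unfolding set_integrable_def integrable_iff_bounded by blast
    also have "(\<integral>\<^sup>+x. ennreal (norm (indicator (cball 0 R) x *\<^sub>R (norm (f x) powr p))) \<partial>dunkl_measure \<alpha>)
        = (\<integral>\<^sup>+z. ennreal (norm (f' z) powr p) * indicator (cball 0 R) z \<partial>dunkl_lborel \<alpha>)"
    proof (rule nn_integral_dunkl_measure_eq)
      show "AE x in lborel. ennreal (norm (indicator (cball 0 R) x *\<^sub>R (norm (f x) powr p)))
          = ennreal (norm (f' x) powr p) * indicator (cball 0 R) x"
        using ff' by eventually_elim (auto simp: indicator_def)
    qed measurable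
    finally show ?thesis .
  qed
  have f_powr: "AE z in lborel. norm (f z) powr p = norm (f' z) powr p"
    using ff' by eventually_elim simp
  note f_ball = set_integral_dunkl_translation[OF assms(1) _ f_powr _ f_finite]
  \<comment> \<open>One pair (r, x) of the supremum is taken, raised to the power p and multiplied
    by r^(d - d p/q), which isolates the integral.\<close>
  have morrey: "(\<integral>\<^sup>+z. ennreal (norm (f' z) powr p) * dunkl_ball_kernel \<alpha> x r z \<partial>dunkl_lborel \<alpha>)
      \<le> ennreal (N powr p * r powr (?d - ?d * p / q))" if r: "0 < r" for x r
  proof -
    define J where "J = (\<integral>\<^sup>+z. ennreal (norm (f' z) powr p) * dunkl_ball_kernel \<alpha> x r z \<partial>dunkl_lborel \<alpha>)"
    have J_fin: "J < \<infinity>" and J_eq: "(LINT y:ball 0 r|dunkl_measure \<alpha>. dunkl_translation \<alpha> x (\<lambda>z. norm (f z) powr p) y) = enn2real J"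
      using f_ball[where x = x and r = r] by (auto simp: J_def)
    have "ennreal (r powr (?d / q) * (1 / r powr ?d * enn2real J) powr (1 / p)) \<le> ennreal N"
      unfolding N(2)[symmetric] dunkl_morrey_norm_def J_eq[symmetric]
      by (rule SUP_upper2[of "(r, x)"]) (use r in auto)
    then have "r powr (?d / q) * (1 / r powr ?d * enn2real J) powr (1 / p) \<le> N"
      using N(1) by (simp add: ennreal_le_iff)
    then have "(r powr (?d / q) * (1 / r powr ?d * enn2real J) powr (1 / p)) powr p \<le> N powr p"
      using p by (intro powr_mono2) auto
    moreover have "(r powr (?d / q) * (1 / r powr ?d * enn2real J) powr (1 / p)) powr p
        = r powr (?d * p / q) * (1 / r powr ?d * enn2real J)"
      using p by (simp add: powr_mult powr_powr)
    ultimately have "r powr (?d - ?d * p / q) * (r powr (?d * p / q) * (1 / r powr ?d * enn2real J))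
        \<le> r powr (?d - ?d * p / q) * N powr p"
      by (intro mult_left_mono) auto
    moreover have "r powr (?d - ?d * p / q) * (r powr (?d * p / q) * (1 / r powr ?d * enn2real J)) = enn2real J"
      using r by (simp add: powr_diff)
    ultimately have "ennreal (enn2real J) \<le> ennreal (N powr p * r powr (?d - ?d * p / q))"
      by (intro ennreal_leI) (simp add: mult.commute)
    moreover have "ennreal (enn2real J) = J"
      using J_fin by simp
    ultimately show ?thesis
      unfolding J_def by metis
  qed
  interpret hs: hausdorff_setting \<alpha> p q \<psi>' f' K "N powr p"
    using assms(1,2) K(1) K' morrey by unfold_locales auto

  define H where "H = (\<lambda>x. LINT t|lborel. hausdorff_integrand \<alpha> \<psi>' f' x t)"
  have H [measurable]: "H \<in> borel_measurable borel"
    unfolding H_def by (rule hs.hausdorff_measurable)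
  \<comment> \<open>At x = 0 the argument of f is 0 for every t, and f may differ from its
    representative there.\<close>
  have integrand_AE: "AE t in lborel. hausdorff_integrand \<alpha> \<psi> f x t = hausdorff_integrand \<alpha> \<psi>' f' x t" if "x \<noteq> 0" for x
    using \<psi>\<psi>' AE_lborel_divide[OF that ff'] by eventually_elim (simp add: hausdorff_integrand_def)
  have integrand_meas: "hausdorff_integrand \<alpha> \<psi> f x \<in> borel_measurable lebesgue" if "x \<noteq> 0" for x
    by (rule borel_measurable_lebesgue_AE_eq[OF hs.integrand_measurable integrand_AE[OF that]])
  have integrand_meas': "hausdorff_integrand \<alpha> \<psi>' f' x \<in> borel_measurable lebesgue" for x
    by (intro measurable_completion) simp
  have nz: "AE x::real in lborel. x \<noteq> 0"
    by (rule AE_lborel_singleton)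
  have HH: "AE x in lborel. dunkl_hausdorff \<alpha> \<psi> f x = H x"
    using nz
  proof eventually_elim
    case (elim x)
    have "dunkl_hausdorff \<alpha> \<psi> f x = (LINT t|lebesgue. hausdorff_integrand \<alpha> \<psi>' f' x t)"
      unfolding dunkl_hausdorff_def
      by (intro integral_cong_AE integrand_meas integrand_meas' AE_completion integrand_AE elim)
    also have "\<dots> = H x"
      unfolding H_def by (rule integral_completion) simp
    finally show ?case .
  qed
  have H_powr: "AE z in lborel. norm (dunkl_hausdorff \<alpha> \<psi> f z) powr p = norm (H z) powr p"
    using HH by eventually_elim simp
  have H_bound: "(\<integral>\<^sup>+z. ennreal (norm (H z) powr p) * dunkl_ball_kernel \<alpha> x r z \<partial>dunkl_lborel \<alpha>)
      \<le> ennreal (K powr p * N powr p * r powr (?d - ?d * p / q))" if "0 < r" for x r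
    unfolding H_def by (rule hs.hausdorff_ball_bound[OF that])
  have H_finite: "(\<integral>\<^sup>+z. ennreal (norm (H z) powr p) * indicator (cball 0 R) z \<partial>dunkl_lborel \<alpha>) < \<infinity>" for R
  proof -
    \<comment> \<open>Centre 0 turns the kernel into an indicator; the radius |R| + 1 is positive
      for every R, and its open ball contains the closed ball of radius R.\<close>
    have "(\<integral>\<^sup>+z. ennreal (norm (H z) powr p) * indicator (cball 0 R) z \<partial>dunkl_lborel \<alpha>)
       \<le> (\<integral>\<^sup>+z. ennreal (norm (H z) powr p) * dunkl_ball_kernel \<alpha> 0 (\<bar>R\<bar> + 1) z \<partial>dunkl_lborel \<alpha>)"
      by (intro nn_integral_mono) (auto simp: dunkl_ball_kernel_zero indicator_def)
    also have "\<dots> < \<infinity>"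
      by (rule le_less_trans[OF H_bound]) auto
    finally show ?thesis .
  qed
  note H_ball = set_integral_dunkl_translation[OF assms(1) _ H_powr _ H_finite]

  have "AE x in lborel. integrable lebesgue (hausdorff_integrand \<alpha> \<psi> f x)"
    using nz hs.AE_integrable
  proof eventually_elim
    case (elim x)
    have "integrable lebesgue (hausdorff_integrand \<alpha> \<psi>' f' x)"
      using elim(2) by (subst integrable_completion) auto
    then show ?case
      using integrable_cong_AE[OF integrand_meas[OF elim(1)] integrand_meas' AE_completion[OF integrand_AE[OF elim(1)]]]
      by simp
  qed
  then have part1: "AE x in lebesgue. integrable lebesgue (hausdorff_integrand \<alpha> \<psi> f x)"
    by (rule AE_completion)

  \<comment> \<open>The rearrangement of \<open>morrey\<close> run backwards: after the p-th root
    the factor r^(-d/q) cancels the prefactor of the norm, so the bound is free of r and x.\<close>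
  have part3: "dunkl_morrey_norm \<alpha> p q (dunkl_hausdorff \<alpha> \<psi> f) \<le> hausdorff_const \<alpha> q \<psi> * dunkl_morrey_norm \<alpha> p q f"
    unfolding dunkl_morrey_norm_def[of _ _ _ "dunkl_hausdorff \<alpha> \<psi> f"]
  proof (rule SUP_least)
    fix w :: "real \<times> real"
    assume "w \<in> {0<..} \<times> UNIV"
    then obtain r x where w: "w = (r, x)" and r: "0 < r"
      by auto
    let ?J = "enn2real (\<integral>\<^sup>+z. ennreal (norm (H z) powr p) * dunkl_ball_kernel \<alpha> x r z \<partial>dunkl_lborel \<alpha>)"
    have "?J \<le> K powr p * N powr p * r powr (?d - ?d * p / q)"
      using H_bound[of r x] r by (intro enn2real_leI) auto
    then have "1 / r powr ?d * ?J \<le> 1 / r powr ?d * (K powr p * N powr p * r powr (?d - ?d * p / q))"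
      by (intro mult_left_mono) auto
    also have "\<dots> = (K * N) powr p * r powr (- ?d * p / q)"
      using r by (simp add: powr_mult powr_diff powr_minus_divide)
    finally have "(1 / r powr ?d * ?J) powr (1 / p) \<le> ((K * N) powr p * r powr (- ?d * p / q)) powr (1 / p)"
      using p by (intro powr_mono2) auto
    also have "\<dots> = K * N * r powr (- ?d / q)"
      using p K(1) N(1) by (simp add: powr_mult powr_powr)
    finally have "r powr (?d / q) * (1 / r powr ?d * ?J) powr (1 / p) \<le> r powr (?d / q) * (K * N * r powr (- ?d / q))"
      by (intro mult_left_mono) auto
    also have "\<dots> = K * N"
      using r by (simp add: powr_minus_divide)
    finally have "ennreal (r powr (?d / q) * (1 / r powr ?d * ?J) powr (1 / p)) \<le> ennreal (K * N)"
      by (rule ennreal_leI)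
    then show "(case w of (r, x) \<Rightarrow> ennreal (r powr (?d / q) * (1 / r powr ?d *
        (LINT y:ball 0 r|dunkl_measure \<alpha>. dunkl_translation \<alpha> x (\<lambda>z. norm (dunkl_hausdorff \<alpha> \<psi> f z) powr p) y)) powr (1 / p)))
      \<le> hausdorff_const \<alpha> q \<psi> * dunkl_morrey_norm \<alpha> p q f"
      using H_ball(2)[where x = x and r = r] K N by (simp add: w ennreal_mult)
  qed

  \<comment> \<open>A finite value of the norm expression alone would prove nothing, because Bochner
    integrals default to 0; local integrability has to come from \<open>H_finite\<close>.\<close>
  have "locally_p_integrable \<alpha> p (dunkl_hausdorff \<alpha> \<psi> f)"
    unfolding locally_p_integrable_def
  proof (intro conjI allI impI)
    show meas: "dunkl_hausdorff \<alpha> \<psi> f \<in> borel_measurable lebesgue"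
      by (rule borel_measurable_lebesgue_AE_eq[OF H HH])
    fix S :: "real set" assume S: "compact S"
    then obtain R where R: "S \<subseteq> cball 0 R"
      using bounded_subset_ballD[of S 0] compact_imp_bounded ball_subset_cball by blast
    have [measurable]: "S \<in> sets borel"
      using S by (intro borel_compact)
    show "set_integrable (dunkl_measure \<alpha>) S (\<lambda>x. norm (dunkl_hausdorff \<alpha> \<psi> f x) powr p)"
      unfolding set_integrable_def
    proof (rule integrableI_bounded)
      have "AE x in lborel. indicator S x *\<^sub>R (norm (dunkl_hausdorff \<alpha> \<psi> f x) powr p)
          = indicator S x * norm (H x) powr p"
        using HH by eventually_elim simp
      then have "(\<lambda>x. indicator S x *\<^sub>R (norm (dunkl_hausdorff \<alpha> \<psi> f x) powr p)) \<in> borel_measurable lebesgue"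
        by (rule borel_measurable_lebesgue_AE_eq[rotated]) measurable
      then show "(\<lambda>x. indicator S x *\<^sub>R (norm (dunkl_hausdorff \<alpha> \<psi> f x) powr p)) \<in> borel_measurable (dunkl_measure \<alpha>)"
        by (simp add: dunkl_measure_def)
      have "(\<integral>\<^sup>+x. ennreal (norm (indicator S x *\<^sub>R (norm (dunkl_hausdorff \<alpha> \<psi> f x) powr p))) \<partial>dunkl_measure \<alpha>)
          = (\<integral>\<^sup>+x. ennreal (norm (H x) powr p) * indicator S x \<partial>dunkl_lborel \<alpha>)"
      proof (rule nn_integral_dunkl_measure_eq)
        show "AE x in lborel. ennreal (norm (indicator S x *\<^sub>R (norm (dunkl_hausdorff \<alpha> \<psi> f x) powr p)))
            = ennreal (norm (H x) powr p) * indicator S x"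
          using HH by eventually_elim (auto simp: indicator_def)
      qed measurable
      also have "\<dots> \<le> (\<integral>\<^sup>+x. ennreal (norm (H x) powr p) * indicator (cball 0 R) x \<partial>dunkl_lborel \<alpha>)"
        using R by (intro nn_integral_mono) (auto simp: indicator_def)
      also have "\<dots> < \<infinity>" by (rule H_finite)
      finally show "(\<integral>\<^sup>+x. ennreal (norm (indicator S x *\<^sub>R (norm (dunkl_hausdorff \<alpha> \<psi> f x) powr p))) \<partial>dunkl_measure \<alpha>) < \<infinity>" .
    qed
  qed
  moreover have "dunkl_morrey_norm \<alpha> p q (dunkl_hausdorff \<alpha> \<psi> f) < \<infinity>"
    using part3 by (rule le_less_trans) (simp add: K N ennreal_mult_less_top)
  ultimately show ?thesis
    using part1 part3 by (simp add: dunkl_morrey_def)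
qed

end
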